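(* Let $u_0$ be a non-negative continuous function on $[0,1]$ with $u_0(0)=u_0(1)=0$, and let $V\in C(\mathbb{R}_+\times[0,1])$ satisfy $V(0,x)=u_0(x)$ for $x\in[0,1]$ and $V(t,0)=V(t,1)=0$ for all $t\ge0$. Let $(Z,\eta)$ be the solution of the parabolic obstacle problem $$\frac{\partial Z(t,x)}{\partial t}-\frac{\partial^2Z(t,x)}{\partial x^2}=\dot\eta(t,x),\quad Z(t,x)\ge -V(t,x),\quad \int_0^t\int_0^1(Z(s,x)+V(s,x))\,\eta(ds,dx)=0,$$ and for $n\ge2$ let $Z^n(t,x)$ be its discretization defined in the context. Then for every $T>0$, $$\lim_{n\to\infty}\ \sup_{0\le t\le T,\,0\le x\le1}|Z^n(t,x)-Z(t,x)|=0.$$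
   Context: Obstacle problem. A pair $(Z,\eta)$ is a solution if: (1) $Z$ is a continuous function on $\mathbb{R}_+\times[0,1]$ with $Z(0,x)=0$, $Z(t,0)=Z(t,1)=0$, $Z(t,x)\ge -V(t,x)$; (2) $\eta$ is a measure on $\mathbb{R}_+\times(0,1)$ with $\eta([0,T]\times(\varepsilon,1-\varepsilon))<\infty$ for all $\varepsilon>0$, $T>0$; (3) for all $t\ge0$ and $\phi\in C^2_0((0,1))$ (twice continuously differentiable with compact support in $(0,1)$), $(Z(t),\phi)-\int_0^t(Z(s),\phi'')ds=\int_0^t\int_0^1\phi(x)\,\eta(ds,dx)$, where $(\cdot,\cdot)$ is the scalar product of $L^2[0,1]$ and $Z(t)=Z(t,\cdot)$; (4) $\int_0^t\int_0^1(Z(s,x)+V(s,x))\,\eta(ds,dx)=0$ for all $t\ge0$. It is known (Nualart–Pardoux) that under the stated conditions on $V$ this problem has a unique solution. Discretization. $A^n=(A^n_{ki})$ is the $(n-1)\times(n-1)$ matrix with $A^n_{kk}=-2$, $A^n_{ki}=1$ if $|k-i|=1$, $A^n_{ki}=0$ if $|k-i|>1$. Set $V^n(t)=(V(t,\frac1n),\dots,V(t,\frac{n-1}n))$. Let $(Z^n(t),\eta^n(t))$, with $Z^n(t)=(Z^n_1(t),\dots,Z^n_{n-1}(t))$, be the unique solution of the Skorohod-type problem in $\mathbb{R}^{n-1}$: $Z^n$ is continuous with $Z^n(t)\ge -V^n(t)$ componentwise; $\eta^n=(\eta^n_1,\dots,\eta^n_{n-1})$ is continuous with each $\eta^n_i$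 increasing (non-decreasing) and $\eta^n_i(0)=0$; $Z^n(t)=\int_0^tn^2A^nZ^n(s)ds+\eta^n(t)$ for all $t\ge0$; and $\sum_{i=1}^{n-1}\int_0^t(Z^n_i(s)+V^n_i(s))\,\eta^n_i(ds)=0$ for all $t\ge 0$. Put $Z^n_0(t)=Z^n_n(t)=0$ and, for $x\in[\frac kn,\frac{k+1}n)$, $k=0,\dots,n-1$, $$Z^n(t,x):=Z^n_k(t)+(nx-k)(Z^n_{k+1}(t)-Z^n_k(t)),$$ with $Z^n(t,1)=0$. *)

theory Defs
  imports "HOL-Analysis.Analysis"
begin

text \<open>The space \<open>C\<^sup>2\<^sub>0((0,1))\<close>; its elements are extended by zero to the whole line.\<close>

definition C2_0 :: "(real \<Rightarrow> real) set" where
  "C2_0 = {\<phi>. (\<forall>x. \<phi> field_differentiable at x) \<and>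
               (\<forall>x. deriv \<phi> field_differentiable at x) \<and>
               continuous_on UNIV (deriv (deriv \<phi>)) \<and>
               compact (closure {x. \<phi> x \<noteq> 0}) \<and>
               closure {x. \<phi> x \<noteq> 0} \<subseteq> {0<..<1}}"

text \<open>
  Time integrals against \<open>\<eta>\<close> run over the closed interval \<open>[0,t]\<close>, so the weak equation at
  \<open>t = 0\<close> excludes mass of \<open>\<eta>\<close> at time zero. The integrand of the weak equation is bounded,
  with support in a set of finite measure, so the Bochner integral is adequate there.
  The complementarity condition uses the Lebesgue integral of the non-negative
  function \<open>Z + V\<close>, because \<open>\<eta>\<close> may have infinite mass near \<open>x = 0\<close> and \<open>x = 1\<close>
  and a Bochner integral would be zero by convention if \<open>Z + V\<close> were not integrable.
\<close>

definition obstacle_solution ::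
    "(real \<Rightarrow> real \<Rightarrow> real) \<Rightarrow> (real \<Rightarrow> real \<Rightarrow> real) \<Rightarrow> (real \<times> real) measure \<Rightarrow> bool" where
  "obstacle_solution V Z \<eta> \<longleftrightarrow>
     continuous_on ({0..} \<times> {0..1}) (\<lambda>(t, x). Z t x) \<and>
     (\<forall>x\<in>{0..1}. Z 0 x = 0) \<and>
     (\<forall>t\<ge>0. Z t 0 = 0 \<and> Z t 1 = 0) \<and>
     (\<forall>t\<ge>0. \<forall>x\<in>{0..1}. Z t x \<ge> - V t x) \<and>
     sets \<eta> = sets (restrict_space borel ({0..} \<times> {0<..<1})) \<and>
     (\<forall>\<epsilon>>0. \<forall>T>0. emeasure \<eta> ({0..T} \<times> {\<epsilon><..<1 - \<epsilon>}) < \<infinity>) \<and>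
     (\<forall>t\<ge>0. \<forall>\<phi>\<in>C2_0.
        integral {0..1} (\<lambda>x. Z t x * \<phi> x)
          - integral {0..t} (\<lambda>s. integral {0..1} (\<lambda>x. Z s x * deriv (deriv \<phi>) x))
        = (LINT p:{0..t} \<times> {0<..<1}|\<eta>. \<phi> (snd p))) \<and>
     (\<forall>t\<ge>0. (\<integral>\<^sup>+ p\<in>{0..t} \<times> {0<..<1}. ennreal (Z (fst p) (snd p) + V (fst p) (snd p)) \<partial>\<eta>) = 0)"

text \<open>
  Vectors in \<open>\<real>\<^sup>n\<^sup>-\<^sup>1\<close> and matrices are functions of indices ranging over \<open>{1..n-1}\<close>;
  values at other indices are never used. The entries of \<open>A\<^sup>n\<close> do not depend on \<open>n\<close>.
\<close>

definition lap_matrix :: "nat \<Rightarrow> nat \<Rightarrow> real" where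
  "lap_matrix k i = (if k = i then -2 else if \<bar>int k - int i\<bar> = 1 then 1 else 0)"

text \<open>
  The measure \<open>h(ds)\<close> on \<open>[0,\<infinity>)\<close> for continuous non-decreasing \<open>h\<close> on \<open>[0,\<infinity>)\<close>.
  As \<open>interval_measure\<close> needs a function on the whole line, \<open>h\<close> is continued
  by the constant \<open>h 0\<close>, which adds no mass.
\<close>

definition stieltjes :: "(real \<Rightarrow> real) \<Rightarrow> real measure" where
  "stieltjes h = interval_measure (\<lambda>s. h (max 0 s))"

definition skorohod_solution ::
    "(real \<Rightarrow> real \<Rightarrow> real) \<Rightarrow> nat \<Rightarrow> (nat \<Rightarrow> real \<Rightarrow> real) \<Rightarrow> (nat \<Rightarrow> real \<Rightarrow> real) \<Rightarrow> bool" where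
  "skorohod_solution V n Z \<eta> \<longleftrightarrow>
     (\<forall>k\<in>{1..n-1}. continuous_on {0..} (Z k)) \<and>
     (\<forall>k\<in>{1..n-1}. \<forall>t\<ge>0. Z k t \<ge> - V t (real k / real n)) \<and>
     (\<forall>k\<in>{1..n-1}. continuous_on {0..} (\<eta> k) \<and> mono_on {0..} (\<eta> k) \<and> \<eta> k 0 = 0) \<and>
     (\<forall>k\<in>{1..n-1}. \<forall>t\<ge>0.
        Z k t = integral {0..t} (\<lambda>s. (real n)\<^sup>2 * (\<Sum>i=1..n-1. lap_matrix k i * Z i s)) + \<eta> k t) \<and>
     (\<forall>t\<ge>0. (\<Sum>i=1..n-1. LINT s:{0..t}|stieltjes (\<eta> i). Z i s + V s (real i / real n)) = 0)"

definition zero_bdry :: "nat \<Rightarrow> (nat \<Rightarrow> real \<Rightarrow> real) \<Rightarrow> nat \<Rightarrow> real \<Rightarrow> real" where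
  "zero_bdry n Z k t = (if k = 0 \<or> k = n then 0 else Z k t)"

text \<open>For \<open>0 \<le> x < 1\<close> the index \<open>k = \<lfloor>n x\<rfloor>\<close> is the one with \<open>k/n \<le> x < (k+1)/n\<close>.\<close>

definition interpolate :: "nat \<Rightarrow> (nat \<Rightarrow> real \<Rightarrow> real) \<Rightarrow> real \<Rightarrow> real \<Rightarrow> real" where
  "interpolate n Z t x =
     (if x = 1 then 0
      else let k = nat \<lfloor>real n * x\<rfloor>
           in zero_bdry n Z k t
              + (real n * x - real k) * (zero_bdry n Z (k + 1) t - zero_bdry n Z k t))"

end

theory Submission
  imports Defs
begin

text \<open>
  The equation for \<open>Z\<close> is tested only in space: convolving \<open>Z(t,\<sqdot>)\<close> with a fixed \<open>C\<^sup>2\<close> bump turns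
  the weak equation into a family of integral equations in time whose reflection terms are
  non-decreasing. Near the boundary the convolution would leave \<open>[0,1]\<close>, so space is first contracted
  to \<open>[a,1-a]\<close> by \<open>x \<mapsto> a + r x\<close> with \<open>r = 1 - 2a\<close>, and time by \<open>t \<mapsto> r\<^sup>2 t\<close>, which preserves the heat
  equation. On the grid the resulting function \<open>W\<close> solves the discrete equation up to a consistency
  error that vanishes as the mesh tends to zero, and it is uniformly close to \<open>Z\<close>.

  Where \<open>Z\<^sup>n\<close> exceeds \<open>W\<close> by a margin, \<open>Z\<^sup>n\<close> lies strictly above the obstacle and \<open>\<eta>\<^sup>n\<close> is inactive; where
  \<open>W\<close> exceeds \<open>Z\<^sup>n\<close> by a margin, \<open>Z\<close> lies strictly above the obstacle on the whole window of the bump and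
  \<open>\<eta>\<close> is inactive. A discrete maximum principle, applied in both directions, therefore bounds
  \<open>Z\<^sup>n - W\<close> uniformly.
\<close>

section \<open>A smooth bump and its second differences\<close>

text \<open>The even function \<open>g s = f (z + s) + f (z - s) - s\<^sup>2 * f'' z\<close> has
  \<open>g' 0 = 0\<close>, and its second derivative is at most \<open>2 * \<omega>\<close> in
  modulus on \<open>[0, h]\<close>; integrating twice gives the bound. Only the oscillation of
  \<open>f''\<close> enters, which suits a bump that is merely twice continuously
  differentiable.\<close>

lemma second_difference_estimate:
  fixes f f' f'' :: "real \<Rightarrow> real"
  assumes f: "\<And>z. (f has_real_derivative f' z) (at z)"
    and f': "\<And>z. (f' has_real_derivative f'' z) (at z)"
    and h: "h > 0"
    and close: "\<And>w. \<bar>w - z\<bar> \<le> h \<Longrightarrow> \<bar>f'' w - f'' z\<bar> \<le> \<omega>"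
  shows "\<bar>f (z + h) - 2 * f z + f (z - h) - h\<^sup>2 * f'' z\<bar> \<le> h\<^sup>2 * \<omega>"
proof -
  define g where "g s = f (z + s) + f (z - s) - s\<^sup>2 * f'' z" for s
  define g' where "g' s = f' (z + s) - f' (z - s) - 2 * s * f'' z" for s
  have dg: "(g has_real_derivative g' s) (at s)" for s
    unfolding g_def g'_def
    by (rule derivative_eq_intros DERIV_chain2[OF f] refl | simp)+
  have dg': "(g' has_real_derivative (f'' (z + s) + f'' (z - s) - 2 * f'' z)) (at s)" for s
    unfolding g'_def
    by (rule derivative_eq_intros DERIV_chain2[OF f'] refl | simp)+
  have b': "\<bar>g' s\<bar> \<le> 2 * \<omega> * s" if s: "0 \<le> s" "s \<le> h" for s
  proof (cases "s = 0")
    case True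
    then show ?thesis by (simp add: g'_def)
  next
    case False
    then have "s > 0" using s by simp
    then obtain \<xi> where \<xi>: "0 < \<xi>" "\<xi> < s"
      and e: "g' s - g' 0 = (s - 0) * (f'' (z + \<xi>) + f'' (z - \<xi>) - 2 * f'' z)"
      using MVT2[of 0 s g' "\<lambda>s. f'' (z + s) + f'' (z - s) - 2 * f'' z", OF _ dg'] by auto
    have "\<bar>f'' (z + \<xi>) - f'' z\<bar> \<le> \<omega>" "\<bar>f'' (z - \<xi>) - f'' z\<bar> \<le> \<omega>"
      using \<xi> s by (auto intro!: close)
    then have "\<bar>f'' (z + \<xi>) + f'' (z - \<xi>) - 2 * f'' z\<bar> \<le> 2 * \<omega>" by linarith
    then have "s * \<bar>f'' (z + \<xi>) + f'' (z - \<xi>) - 2 * f'' z\<bar> \<le> s * (2 * \<omega>)"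
      using s by (intro mult_left_mono) auto
    with e s have "\<bar>g' s - g' 0\<bar> \<le> s * (2 * \<omega>)" by (simp add: abs_mult)
    then show ?thesis by (simp add: g'_def mult.commute mult.left_commute)
  qed
  \<comment> \<open>Monotonicity of \<open>u\<close> and \<open>v\<close> encodes the two signs of
    the bound on \<open>g'\<close>; their values at \<open>0\<close> and \<open>h\<close>, with
    \<open>g 0 = 2 * f z\<close>, give the two-sided estimate.\<close>
  define u where "u s = \<omega> * s\<^sup>2 - g s" for s
  define v where "v s = \<omega> * s\<^sup>2 + g s" for s
  have du: "(u has_real_derivative (2 * \<omega> * s - g' s)) (at s)" for s
    unfolding u_def by (rule derivative_eq_intros dg refl | simp)+
  have dv: "(v has_real_derivative (2 * \<omega> * s + g' s)) (at s)" for s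
    unfolding v_def by (rule derivative_eq_intros dg refl | simp)+
  have "u 0 \<le> u h"
  proof (rule DERIV_nonneg_imp_nondecreasing[where f=u])
    fix s assume "0 \<le> s" "s \<le> h"
    with b'[of s] show "\<exists>y. (u has_real_derivative y) (at s) \<and> 0 \<le> y"
      by (intro exI[of _ "2 * \<omega> * s - g' s"] conjI du) auto
  qed (use h in auto)
  moreover have "v 0 \<le> v h"
  proof (rule DERIV_nonneg_imp_nondecreasing[where f=v])
    fix s assume "0 \<le> s" "s \<le> h"
    with b'[of s] show "\<exists>y. (v has_real_derivative y) (at s) \<and> 0 \<le> y"
      by (intro exI[of _ "2 * \<omega> * s + g' s"] conjI dv) auto
  qed (use h in auto)
  ultimately show ?thesis
    by (simp add: u_def v_def g_def abs_le_iff algebra_simps)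
qed

text \<open>The delicate point is \<open>u = 0\<close>: the difference quotient is dominated by
  \<open>(max 0 h) ^ m\<close>, which tends to zero because \<open>m \<ge> 1\<close>. Elsewhere the
  function is locally zero or a plain power.\<close>

lemma DERIV_max_0_power:
  fixes u :: real
  assumes "m \<ge> 1"
  shows "((\<lambda>u. (max 0 u) ^ Suc m) has_real_derivative (real (Suc m) * (max 0 u) ^ m)) (at u)"
proof -
  consider "u < 0" | "u > 0" | "u = 0" by linarith
  then show ?thesis
  proof cases
    case 1
    have "((\<lambda>u::real. 0) has_real_derivative (real (Suc m) * (max 0 u) ^ m)) (at u)"
      using 1 assms by (simp add: zero_power)
    then show ?thesis
      by (rule has_field_derivative_transform_within_open[where S="{..<0}"]) (use 1 in auto)
  next
    case 2
    have "((\<lambda>u::real. u ^ Suc m) has_real_derivative (real (Suc m) * (max 0 u) ^ m)) (at u)"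
      using 2 DERIV_power_Suc[OF DERIV_ident, where n=m and x=u and s=UNIV] by simp
    then show ?thesis
      by (rule has_field_derivative_transform_within_open[where S="{0<..}"]) (use 2 in auto)
  next
    case 3
    have "((\<lambda>h::real. (max 0 h) ^ m) \<longlongrightarrow> (max 0 0) ^ m) (at 0)"
      by (intro tendsto_intros)
    moreover have "(max 0 0 :: real) ^ m = 0" using assms by (simp add: zero_power)
    ultimately have l: "((\<lambda>h::real. (max 0 h) ^ m) \<longlongrightarrow> 0) (at 0)" by (simp only:)
    have "((\<lambda>h::real. ((max 0 h) ^ Suc m) / h) \<longlongrightarrow> 0) (at 0)"
      by (rule Lim_null_comparison[OF _ l])
         (auto simp: max_def eventually_at intro!: exI[of _ 1])
    then have "((\<lambda>u. (max 0 u) ^ Suc m) has_real_derivative 0) (at u)"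
      using 3 by (simp add: DERIV_def)
    moreover have "real (Suc m) * (max 0 u) ^ m = 0" using 3 assms by (simp add: zero_power)
    ultimately show ?thesis by (simp only:)
  qed
qed

text \<open>The bump is the normalised truncated cube of
  \<open>\<delta>\<^sup>2 - z\<^sup>2\<close>; three is the least integer power for which truncation
  leaves a continuous second derivative. Uniform continuity of \<open>\<phi>''\<close> later makes
  the consistency error uniform over all nodes.\<close>

lemma C2_bump_exists:
  fixes \<delta> :: real
  assumes "\<delta> > 0"
  obtains \<phi> \<phi>' \<phi>'' :: "real \<Rightarrow> real"
  where "\<And>z. (\<phi> has_real_derivative \<phi>' z) (at z)"
    and "\<And>z. (\<phi>' has_real_derivative \<phi>'' z) (at z)"
    and "uniformly_continuous_on UNIV \<phi>''"
    and "\<And>z. \<phi> z \<ge> 0"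
    and "\<And>z. \<bar>z\<bar> \<ge> \<delta> \<Longrightarrow> \<phi> z = 0"
    and "(\<phi> has_integral 1) {-\<delta>..\<delta>}"
proof -
  define q where "q z = (max 0 (\<delta>\<^sup>2 - z\<^sup>2)) ^ 3" for z :: real
  define q' where "q' z = 3 * (max 0 (\<delta>\<^sup>2 - z\<^sup>2)) ^ 2 * (-2 * z)" for z :: real
  define q'' where "q'' z = 3 * (2 * max 0 (\<delta>\<^sup>2 - z\<^sup>2) * (-2 * z)) * (-2 * z)
     + 3 * (max 0 (\<delta>\<^sup>2 - z\<^sup>2)) ^ 2 * (-2)" for z :: real
  have d: "((\<lambda>z. \<delta>\<^sup>2 - z\<^sup>2) has_real_derivative (-2 * z)) (at z)" for z
    by (auto intro!: derivative_eq_intros)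
  have dq: "(q has_real_derivative q' z) (at z)" for z
    using DERIV_chain2[OF DERIV_max_0_power[of 2 "\<delta>\<^sup>2 - z\<^sup>2"] d]
    by (simp add: q_def[abs_def] q'_def eval_nat_numeral)
  have d2: "((\<lambda>z. (max 0 (\<delta>\<^sup>2 - z\<^sup>2)) ^ 2) has_real_derivative 2 * max 0 (\<delta>\<^sup>2 - z\<^sup>2) * (-2 * z)) (at z)" for z
    using DERIV_chain2[OF DERIV_max_0_power[of 1 "\<delta>\<^sup>2 - z\<^sup>2"] d]
    by (simp add: eval_nat_numeral)
  have dq': "(q' has_real_derivative q'' z) (at z)" for z
    unfolding q'_def[abs_def] q''_def
    by (rule derivative_eq_intros d2 refl | simp)+
  have zero: "\<delta>\<^sup>2 - z\<^sup>2 \<le> 0" if "\<bar>z\<bar> \<ge> \<delta>" for z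
    using that assms by (simp add: abs_le_square_iff[symmetric])
  have cont: "continuous_on UNIV q''"
    unfolding q''_def[abs_def] by (intro continuous_intros)
  have uc: "uniformly_continuous_on UNIV q''"
    unfolding uniformly_continuous_on_def
  proof (intro allI impI)
    fix e :: real assume "e > 0"
    \<comment> \<open>The margin \<open>1\<close> beyond the support matters: two points at distance
      below \<open>1\<close> either both lie in this interval or both lie where \<open>q''\<close>
      vanishes.\<close>
    have "uniformly_continuous_on {-\<delta>-1..\<delta>+1} q''"
      by (rule compact_uniformly_continuous) (auto intro: continuous_on_subset[OF cont])
    then obtain d where d: "d > 0" and dd: "\<And>x y. x \<in> {-\<delta>-1..\<delta>+1} \<Longrightarrow> y \<in> {-\<delta>-1..\<delta>+1} \<Longrightarrow>
        dist y x < d \<Longrightarrow> dist (q'' y) (q'' x) < e"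
      using \<open>e > 0\<close> unfolding uniformly_continuous_on_def by metis
    have "dist (q'' y) (q'' x) < e" if "dist y x < min d 1" for x y
    proof (cases "x \<in> {-\<delta>-1..\<delta>+1} \<and> y \<in> {-\<delta>-1..\<delta>+1}")
      case True
      then show ?thesis using that by (intro dd) auto
    next
      case False
      then have "\<bar>x\<bar> \<ge> \<delta>" "\<bar>y\<bar> \<ge> \<delta>" using that by (auto simp: dist_real_def)
      then have "q'' x = 0" "q'' y = 0" using zero[of x] zero[of y] by (auto simp: q''_def)
      then show ?thesis using \<open>e > 0\<close> by simp
    qed
    then show "\<exists>d>0. \<forall>x\<in>UNIV. \<forall>x'\<in>UNIV. dist x' x < d \<longrightarrow> dist (q'' x') (q'' x) < e"
      using d by (intro exI[of _ "min d 1"]) auto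
  qed
  have cq: "continuous_on S q" for S
    unfolding q_def[abs_def] by (intro continuous_intros)
  define I where "I = integral {-\<delta>..\<delta>} q"
  have qI: "(q has_integral I) {-\<delta>..\<delta>}"
    unfolding I_def by (intro integrable_integral integrable_continuous_interval cq)
  have "I \<noteq> 0"
  proof
    assume "I = 0"
    then have "q 0 = 0"
      using has_integral_0_cbox_imp_0[of "-\<delta>" \<delta> q 0] cq qI assms by (auto simp: q_def)
    then show False using assms by (simp add: q_def)
  qed
  moreover have "I \<ge> 0"
    by (rule has_integral_nonneg[OF qI]) (auto simp: q_def)
  ultimately have "I > 0" by simp
  show ?thesis
  proof (rule that[of "\<lambda>z. q z / I" "\<lambda>z. q' z / I" "\<lambda>z. q'' z / I"])
    show "((\<lambda>z. q z / I) has_real_derivative q' z / I) (at z)" for z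
      by (intro DERIV_cdivide dq)
    show "((\<lambda>z. q' z / I) has_real_derivative q'' z / I) (at z)" for z
      by (intro DERIV_cdivide dq')
    show "uniformly_continuous_on UNIV (\<lambda>z. q'' z / I)"
      using bounded_linear.uniformly_continuous_on[OF bounded_linear_divide uc] .
    show "q z / I \<ge> 0" for z using \<open>I > 0\<close> by (simp add: q_def)
    show "q z / I = 0" if "\<bar>z\<bar> \<ge> \<delta>" for z using zero[OF that] by (simp add: q_def)
    show "((\<lambda>z. q z / I) has_integral 1) {-\<delta>..\<delta>}"
      using has_integral_divide[OF qI, of I] \<open>I > 0\<close> by simp
  qed
qed

section \<open>The discrete comparison principle\<close>

text \<open>
  At a positive space-time maximum of \<open>X - Y - \<epsilon> - 3 e t\<close> the discrete Laplacian is non-positive, and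
  just before it the force \<open>a\<close> is inactive, so the difference strictly decreases there.
\<close>

lemma discrete_comparison:
  fixes X Y F G a b :: "nat \<Rightarrow> real \<Rightarrow> real"
  assumes e: "e > 0" and c: "c \<ge> 0"
    and cont: "\<And>k. k \<le> n \<Longrightarrow> continuous_on {0..T} (X k)" "\<And>k. k \<le> n \<Longrightarrow> continuous_on {0..T} (Y k)"
    and contF: "\<And>k. 0 < k \<Longrightarrow> k < n \<Longrightarrow> continuous_on {0..T} (F k)"
    and contG: "\<And>k. 0 < k \<Longrightarrow> k < n \<Longrightarrow> continuous_on {0..T} (G k)"
    and X: "\<And>k t. 0 < k \<Longrightarrow> k < n \<Longrightarrow> t \<in> {0..T} \<Longrightarrow> X k t = integral {0..t} (F k) + a k t"
    and Y: "\<And>k t. 0 < k \<Longrightarrow> k < n \<Longrightarrow> t \<in> {0..T} \<Longrightarrow> Y k t = integral {0..t} (G k) + b k t"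
    and F: "\<And>k t. 0 < k \<Longrightarrow> k < n \<Longrightarrow> t \<in> {0..T} \<Longrightarrow>
       \<bar>F k t - c * (X (k + 1) t - 2 * X k t + X (k - 1) t)\<bar> \<le> e"
    and G: "\<And>k t. 0 < k \<Longrightarrow> k < n \<Longrightarrow> t \<in> {0..T} \<Longrightarrow>
       \<bar>G k t - c * (Y (k + 1) t - 2 * Y k t + Y (k - 1) t)\<bar> \<le> e"
    and b: "\<And>k s t. 0 < k \<Longrightarrow> k < n \<Longrightarrow> 0 \<le> s \<Longrightarrow> s \<le> t \<Longrightarrow> t \<le> T \<Longrightarrow> b k s \<le> b k t"
    and a: "\<And>k s t. 0 < k \<Longrightarrow> k < n \<Longrightarrow> 0 \<le> s \<Longrightarrow> s \<le> t \<Longrightarrow> t \<le> T \<Longrightarrow>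
       (\<And>u. u \<in> {s..t} \<Longrightarrow> X k u > Y k u + \<epsilon>) \<Longrightarrow> a k s = a k t"
    and bdry: "\<And>t. t \<in> {0..T} \<Longrightarrow> X 0 t \<le> Y 0 t + \<epsilon>" "\<And>t. t \<in> {0..T} \<Longrightarrow> X n t \<le> Y n t + \<epsilon>"
    and init: "\<And>k. 0 < k \<Longrightarrow> k < n \<Longrightarrow> X k 0 \<le> Y k 0 + \<epsilon>"
    and kt: "k \<le> n" "t \<in> {0..T}"
  shows "X k t \<le> Y k t + \<epsilon> + 3 * e * T"
proof -
  \<comment> \<open>The slope \<open>3 * e\<close> beats the two consistency errors, together
    \<open>2 * e\<close>, and the variation \<open>e / 2\<close> of the discrete Laplacian just
    before the maximum; a strict decrease remains.\<close>
  define D where "D k t = X k t - Y k t - \<epsilon> - 3 * e * t" for k t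
  have "T \<ge> 0" using kt by auto
  have contD: "continuous_on {0..T} (D k)" if "k \<le> n" for k
    unfolding D_def[abs_def] by (intro continuous_intros cont that)
  have "\<exists>t\<in>{0..T}. \<forall>s\<in>{0..T}. D k s \<le> D k t" if "k \<le> n" for k
    using continuous_attains_sup[OF _ _ contD[OF that]] \<open>T \<ge> 0\<close> by auto
  then obtain \<tau> where \<tau>: "\<And>k. k \<le> n \<Longrightarrow> \<tau> k \<in> {0..T}" "\<And>k s. k \<le> n \<Longrightarrow> s \<in> {0..T} \<Longrightarrow> D k s \<le> D k (\<tau> k)"
    by metis
  have "Max ((\<lambda>k. D k (\<tau> k)) ` {..n}) \<in> (\<lambda>k. D k (\<tau> k)) ` {..n}" by (intro Max_in) auto
  then obtain K where K: "K \<le> n" and Keq: "D K (\<tau> K) = Max ((\<lambda>k. D k (\<tau> k)) ` {..n})" by (smt (verit) atMost_iff imageE)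
  have Kmax: "D k (\<tau> k) \<le> D K (\<tau> K)" if "k \<le> n" for k
    unfolding Keq using that by (intro Max_ge) auto
  define t0 where "t0 = \<tau> K"
  have t0: "t0 \<in> {0..T}" using \<tau>(1)[OF K] by (simp add: t0_def)
  have max: "D k s \<le> D K t0" if "k \<le> n" "s \<in> {0..T}" for k s
    using \<tau>(2)[OF that] Kmax[OF that(1)] by (simp add: t0_def)
  have "D K t0 \<le> 0"
  proof (rule ccontr)
    assume "\<not> D K t0 \<le> 0"
    then have pos: "D K t0 > 0" by simp
    have et: "3 * e * t0 \<ge> 0" using e t0 by auto
    have "K \<noteq> 0" using bdry(1)[OF t0] pos et unfolding D_def by (intro notI) simp
    moreover have "K \<noteq> n" using bdry(2)[OF t0] pos et unfolding D_def by (intro notI) simp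
    ultimately have K0: "0 < K" "K < n" using K by auto
    have "t0 \<noteq> 0" using init[OF K0] pos by (auto simp: D_def)
    then have "t0 > 0" using t0 by auto
    define L where "L s = c * (D (K + 1) s - 2 * D K s + D (K - 1) s)" for s
    have L0: "L t0 \<le> 0"
    proof -
      have "D (K + 1) t0 \<le> D K t0" "D (K - 1) t0 \<le> D K t0" using K0 t0 by (intro max; simp)+
      then show ?thesis unfolding L_def using c by (intro mult_nonneg_nonpos) auto
    qed
    have contL: "continuous_on {0..T} L"
      unfolding L_def[abs_def] using K0 by (intro continuous_intros contD) auto
    obtain d1 where d1: "d1 > 0" "\<And>s. s \<in> {0..T} \<Longrightarrow> dist s t0 < d1 \<Longrightarrow> dist (L s) (L t0) < e / 2"
      using contL t0 e unfolding continuous_on_iff by (meson half_gt_zero)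
    obtain d2 where d2: "d2 > 0" "\<And>s. s \<in> {0..T} \<Longrightarrow> dist s t0 < d2 \<Longrightarrow> dist (D K s) (D K t0) < D K t0"
      using contD[OF K] t0 pos unfolding continuous_on_iff by meson
    \<comment> \<open>Within \<open>d1\<close> of \<open>t0\<close> the Laplacian term stays below
      \<open>e / 2\<close>; within \<open>d2\<close> the difference stays positive, so
      \<open>a\<close> is inactive. The maximum with \<open>0\<close> keeps \<open>s\<close> in the
      time range, and \<open>t0 > 0\<close> still gives \<open>s < t0\<close>.\<close>
    define s where "s = max 0 (t0 - min d1 d2 / 2)"
    have s: "0 \<le> s" "s < t0" using \<open>t0 > 0\<close> d1(1) d2(1) by (auto simp: s_def)
    have near: "dist u t0 < d1" "dist u t0 < d2" "u \<in> {0..T}" if "u \<in> {s..t0}" for u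
      using that t0 d1(1) d2(1) by (auto simp: s_def dist_real_def max_def min_def split: if_splits)
    have "X K u > Y K u + \<epsilon>" if "u \<in> {s..t0}" for u
    proof -
      have "D K u > 0" using d2(2)[OF near(3)[OF that] near(2)[OF that]] by (auto simp: dist_real_def)
      moreover have "3 * e * u \<ge> 0" using e that s by auto
      ultimately show ?thesis by (simp add: D_def)
    qed
    then have aeq: "a K s = a K t0" using s t0 by (intro a[OF K0]) auto
    have bl: "b K s \<le> b K t0" using s t0 by (intro b[OF K0]) auto
    have iF: "F K integrable_on {p..q}" if "0 \<le> p" "q \<le> T" for p q
      using continuous_on_subset[OF contF[OF K0], of "{p..q}"] that
      by (intro integrable_continuous_interval) auto
    have iG: "G K integrable_on {p..q}" if "0 \<le> p" "q \<le> T" for p q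
      using continuous_on_subset[OF contG[OF K0], of "{p..q}"] that
      by (intro integrable_continuous_interval) auto
    have XF: "X K t0 - X K s = integral {s..t0} (F K)"
      using Henstock_Kurzweil_Integration.integral_combine[of 0 s t0 "F K"] iF[of 0 t0]
        s t0 X[OF K0, of s] X[OF K0, of t0] aeq by auto
    \<comment> \<open>The force \<open>b\<close> may act on \<open>[s, t0]\<close>, but it only
      lifts \<open>Y\<close>, which works against a positive maximum of \<open>X - Y\<close>; an
      inequality suffices.\<close>
    have YG: "Y K t0 - Y K s \<ge> integral {s..t0} (G K)"
      using Henstock_Kurzweil_Integration.integral_combine[of 0 s t0 "G K"] iG[of 0 t0]
        s t0 Y[OF K0, of s] Y[OF K0, of t0] bl by auto
    have "integral {s..t0} (\<lambda>u. F K u - G K u) \<le> integral {s..t0} (\<lambda>u. 5 / 2 * e)"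
    proof (rule integral_le)
      show "(\<lambda>u. F K u - G K u) integrable_on {s..t0}"
        using s t0 by (intro integrable_diff iF iG) auto
      fix u assume u: "u \<in> {s..t0}"
      have "L u < e / 2"
        using d1(2)[OF near(3)[OF u] near(1)[OF u]] L0 unfolding dist_real_def by linarith
      moreover have "F K u - G K u \<le> L u + 2 * e"
      proof -
        \<comment> \<open>The shift \<open>\<epsilon> + 3 * e * u\<close> is the same at all nodes
          and cancels in the second difference.\<close>
        have "L u = c * (X (K + 1) u - 2 * X K u + X (K - 1) u)
           - c * (Y (K + 1) u - 2 * Y K u + Y (K - 1) u)"
          by (simp add: L_def D_def algebra_simps)
        then show ?thesis using F[OF K0 near(3)[OF u]] G[OF K0 near(3)[OF u]] by linarith
      qed
      ultimately show "F K u - G K u \<le> 5 / 2 * e" by simp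
    qed auto
    moreover have "integral {s..t0} (\<lambda>u. F K u - G K u) = integral {s..t0} (F K) - integral {s..t0} (G K)"
      using s t0 by (intro integral_diff iF iG) auto
    moreover have "integral {s..t0} (\<lambda>u. 5 / 2 * e) = 5 / 2 * e * (t0 - s)"
      using s by simp
    ultimately have "(X K t0 - X K s) - (Y K t0 - Y K s) \<le> 5 / 2 * e * (t0 - s)"
      using XF YG by linarith
    moreover have "5 / 2 * e * (t0 - s) < 3 * e * (t0 - s)" using e s by simp
    moreover have "3 * e * (t0 - s) = 3 * e * t0 - 3 * e * s" by (simp add: algebra_simps)
    ultimately have "D K t0 < D K s" unfolding D_def by linarith
    then show False using max[OF K, of s] s t0 by auto
  qed
  then have "D k t \<le> 0" using max[OF kt] by linarith
  moreover have "3 * e * t \<le> 3 * e * T" using e kt by auto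
  ultimately show ?thesis by (simp add: D_def)
qed

section \<open>Inactivity of the reflection off the obstacle\<close>

text \<open>A non-negative integrand with zero integral vanishes almost everywhere. Where it is
  strictly positive there can be no mass, and the mass of \<open>(s, t]\<close> is the increment of
  \<open>h\<close>.\<close>

lemma stieltjes_flat:
  fixes h g :: "real \<Rightarrow> real"
  assumes h: "continuous_on {0..} h" "mono_on {0..} h"
    and g: "continuous_on {0..t} g" "\<And>u. u \<in> {0..t} \<Longrightarrow> g u \<ge> 0"
    and zero: "(LINT u:{0..t}|stieltjes h. g u) = 0"
    and s: "0 \<le> s" "s \<le> t" and pos: "\<And>u. u \<in> {s..t} \<Longrightarrow> g u > 0"
  shows "h s = h t"
proof -
  define H where "H u = h (max 0 u)" for u
  have monoH: "H x \<le> H y" if "x \<le> y" for x y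
    unfolding H_def by (rule mono_onD[OF h(2)]) (use that in auto)
  have contH: "continuous_on UNIV H"
    unfolding H_def[abs_def] by (rule continuous_on_compose2[OF h(1)]) (auto intro!: continuous_intros)
  have M: "stieltjes h = interval_measure H" by (simp add: stieltjes_def H_def[abs_def])
  have sets[measurable_cong]: "sets (stieltjes h) = sets borel" by (simp add: M)
  have fin: "emeasure (stieltjes h) {0..t} < \<infinity>"
    unfolding M using s by (subst emeasure_interval_measure_Icc[OF _ monoH contH]) auto
  obtain B where B: "\<And>u. u \<in> {0..t} \<Longrightarrow> norm (g u) \<le> B"
    using compact_imp_bounded[OF compact_continuous_image[OF g(1) compact_Icc]]
    unfolding bounded_iff by blast
  have meas: "(\<lambda>u. indicator {0..t} u *\<^sub>R g u) \<in> borel_measurable (stieltjes h)"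
    unfolding measurable_cong_sets[OF sets refl]
    by (intro borel_measurable_continuous_on_indicator g) auto
  \<comment> \<open>Integrability must be established first: the Bochner integral of a
    non-integrable function is zero by convention, and \<open>zero\<close> would then carry no
    information.\<close>
  have "integrable (stieltjes h) (\<lambda>u. indicator {0..t} u *\<^sub>R g u)"
    by (rule integrableI_bounded_set[where A="{0..t}" and B=B])
       (use meas fin B in \<open>auto simp: sets\<close>)
  moreover have "AE u in stieltjes h. 0 \<le> indicator {0..t} u *\<^sub>R g u"
    using g(2) by (auto simp: indicator_def)
  ultimately have ae: "AE u in stieltjes h. indicator {0..t} u *\<^sub>R g u = 0"
    using zero unfolding set_lebesgue_integral_def by (subst (asm) integral_nonneg_eq_0_iff_AE)
  have "AE u in stieltjes h. u \<notin> {s<..t}"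
    using ae
  proof eventually_elim
    case (elim u)
    show ?case
    proof
      assume "u \<in> {s<..t}"
      then show False using elim pos[of u] s by (simp add: indicator_def)
    qed
  qed
  then have "emeasure (stieltjes h) {s<..t} = 0"
    by (subst (asm) AE_iff_measurable[where N="{s<..t}"]) (auto simp: M)
  then have "H t - H s \<le> 0"
    unfolding M using s contH
    by (subst (asm) emeasure_interval_measure_Ioc[OF _ monoH])
       (auto simp: continuous_on_eq_continuous_within ennreal_eq_0_iff intro: continuous_within_subset)
  with monoH[of s t] s show ?thesis by (simp add: H_def)
qed

text \<open>Complementarity is stated for the sum over all nodes. Each summand is non-negative
  because of the obstacle constraint, so each vanishes separately, and the scalar statement
  \<open>stieltjes_flat\<close> applies at node \<open>k\<close>.\<close>

lemma skorohod_reflection_flat: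
  assumes sol: "skorohod_solution V n Z \<eta>"
    and V: "continuous_on ({0..} \<times> {0..1}) (\<lambda>(t, x). V t x)"
    and k: "k \<in> {1..n-1}" and s: "0 \<le> s" "s \<le> t"
    and pos: "\<And>u. u \<in> {s..t} \<Longrightarrow> Z k u + V u (real k / real n) > 0"
  shows "\<eta> k s = \<eta> k t"
proof -
  let ?I = "\<lambda>i. LINT s:{0..t}|stieltjes (\<eta> i). Z i s + V s (real i / real n)"
  have nonneg: "Z i u + V u (real i / real n) \<ge> 0" if "i \<in> {1..n-1}" "u \<ge> 0" for i u
  proof -
    have "Z i u \<ge> - V u (real i / real n)"
      using sol that unfolding skorohod_solution_def by blast
    then show ?thesis by simp
  qed
  have "?I i \<ge> 0" if "i \<in> {1..n-1}" for i
    unfolding set_lebesgue_integral_def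
    by (rule Bochner_Integration.integral_nonneg) (use nonneg that in \<open>auto simp: indicator_def\<close>)
  moreover have "sum ?I {1..n-1} = 0"
    using sol s unfolding skorohod_solution_def by auto
  ultimately have "\<forall>i\<in>{1..n-1}. ?I i = 0"
    by (subst (asm) sum_nonneg_eq_0_iff) auto
  then have zero: "?I k = 0" using k by blast
  have \<eta>: "continuous_on {0..} (\<eta> k)" "mono_on {0..} (\<eta> k)"
    using sol k unfolding skorohod_solution_def by blast+
  have "continuous_on {0..t} (Z k)"
    by (rule continuous_on_subset[of "{0..}"]) (use sol k in \<open>auto simp: skorohod_solution_def\<close>)
  moreover have "continuous_on {0..t} (\<lambda>u. V u (real k / real n))"
  proof -
    have "continuous_on {0..t} (\<lambda>u. (u, real k / real n))" by (intro continuous_intros)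
    moreover have "(\<lambda>u. (u, real k / real n)) ` {0..t} \<subseteq> {0..} \<times> {0..1}"
      using k by (auto simp: divide_simps)
    ultimately show ?thesis using continuous_on_compose2[OF V] by fastforce
  qed
  ultimately have "continuous_on {0..t} (\<lambda>u. Z k u + V u (real k / real n))"
    by (rule continuous_on_add)
  then show ?thesis
    by (rule stieltjes_flat[OF \<eta> _ _ zero s pos]) (use nonneg k in auto)
qed

lemma skorohod_laplacian:
  assumes "k \<in> {1..n-1}"
  shows "(\<Sum>i=1..n-1. lap_matrix k i * Z i s)
    = zero_bdry n Z (k + 1) s - 2 * zero_bdry n Z k s + zero_bdry n Z (k - 1) s"
proof -
  have "(\<Sum>i=1..n-1. lap_matrix k i * Z i s)
     = (\<Sum>i=1..n-1. (if i = k + 1 then zero_bdry n Z (k + 1) s else 0)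
          + (if i = k then - 2 * zero_bdry n Z k s else 0)
          + (if i = k - 1 then zero_bdry n Z (k - 1) s else 0))"
  proof (rule sum.cong)
    fix i assume i: "i \<in> {1..n-1}"
    then have z: "zero_bdry n Z i s = Z i s" by (auto simp: zero_bdry_def)
    consider "i = k + 1" | "i = k" | "i + 1 = k" | "i \<noteq> k + 1" "i \<noteq> k" "i + 1 \<noteq> k" by blast
    then show "lap_matrix k i * Z i s = (if i = k + 1 then zero_bdry n Z (k + 1) s else 0)
          + (if i = k then - 2 * zero_bdry n Z k s else 0)
          + (if i = k - 1 then zero_bdry n Z (k - 1) s else 0)"
    proof cases
      case 4
      then have "\<bar>int k - int i\<bar> \<noteq> 1" "i \<noteq> k - 1" using assms i by auto
      with 4 show ?thesis by (simp add: lap_matrix_def)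
    qed (use z i in \<open>auto simp: lap_matrix_def\<close>)
  qed simp
  also have "\<dots> = zero_bdry n Z (k + 1) s - 2 * zero_bdry n Z k s + zero_bdry n Z (k - 1) s"
  proof -
    \<comment> \<open>For \<open>k = 1\<close> or \<open>k = n - 1\<close> a neighbour falls outside
      the summation range; its missing term agrees with the zero boundary value.\<close>
    have "k - 1 \<notin> {1..n-1} \<longrightarrow> zero_bdry n Z (k - 1) s = 0" "k + 1 \<notin> {1..n-1} \<longrightarrow> zero_bdry n Z (k + 1) s = 0"
      using assms by (auto simp: zero_bdry_def)
    then show ?thesis using assms by (simp only: sum.distrib sum.delta finite_atLeastAtMost) auto
  qed
  finally show ?thesis .
qed

text \<open>These are the two properties of a force that the comparison principle asks for, here for
  \<open>\<eta>\<close> tested against a profile supported away from the boundary. Monotonicity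
  comes from \<open>\<phi> \<ge> 0\<close>; flatness holds because complementarity forbids mass
  where \<open>Z + V > 0\<close>.\<close>

lemma obstacle_reflection:
  fixes \<phi> :: "real \<Rightarrow> real"
  assumes sol: "obstacle_solution V Z \<eta>"
    and \<phi>: "continuous_on UNIV \<phi>" "\<And>x. \<phi> x \<ge> 0" "\<And>x. x \<notin> {c<..<d} \<Longrightarrow> \<phi> x = 0"
    and cd: "0 < c" "d < 1"
    and s: "0 \<le> s" "s \<le> t"
  shows obstacle_reflection_mono:
      "(LINT p:{0..s} \<times> {0<..<1}|\<eta>. \<phi> (snd p)) \<le> (LINT p:{0..t} \<times> {0<..<1}|\<eta>. \<phi> (snd p))"
    and obstacle_reflection_flat:
      "continuous_on ({0..} \<times> {0..1}) (\<lambda>(t, x). V t x) \<Longrightarrow>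
       (\<And>u x. u \<in> {s..t} \<Longrightarrow> x \<in> {c<..<d} \<Longrightarrow> Z u x + V u x > 0) \<Longrightarrow>
       (LINT p:{0..s} \<times> {0<..<1}|\<eta>. \<phi> (snd p)) = (LINT p:{0..t} \<times> {0<..<1}|\<eta>. \<phi> (snd p))"
proof -
  define f where "f r p = indicator ({0..r} \<times> {0<..<1}) p *\<^sub>R \<phi> (snd p)" for r and p :: "real \<times> real"
  have sets: "sets \<eta> = sets (restrict_space borel ({0..} \<times> {0<..<1}))"
    and finite: "\<And>\<epsilon> T. \<epsilon> > 0 \<Longrightarrow> T > 0 \<Longrightarrow> emeasure \<eta> ({0..T} \<times> {\<epsilon><..<1 - \<epsilon>}) < \<infinity>"
    and Zcont: "continuous_on ({0..} \<times> {0..1}) (\<lambda>(t, x). Z t x)"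
    and compl: "(\<integral>\<^sup>+ p\<in>{0..t} \<times> {0<..<1}. ennreal (Z (fst p) (snd p) + V (fst p) (snd p)) \<partial>\<eta>) = 0"
    using sol s unfolding obstacle_solution_def by auto
  have bS: "{0..r} \<times> {x<..<y} \<in> sets borel" for r x y :: real
    by (intro borel_Times) auto
  have bO: "{0..} \<times> {0<..<1} \<in> sets (borel :: (real \<times> real) measure)"
    by (intro borel_Times) auto
  have in_sets: "{0..r} \<times> {x<..<y} \<in> sets \<eta>" if "x \<ge> 0" "y \<le> 1" for r x y :: real
    unfolding sets using that bS bO by (subst sets_restrict_space_iff) auto
  have meas: "f r \<in> borel_measurable \<eta>" for r
  proof -
    have "(\<lambda>p. \<phi> (snd p)) \<in> borel_measurable borel"
      by (intro borel_measurable_continuous_onI continuous_on_compose2[OF \<phi>(1)] continuous_intros) auto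
    then have "f r \<in> borel_measurable borel"
      unfolding f_def using bS by (intro borel_measurable_scaleR borel_measurable_indicator) auto
    then show ?thesis
      unfolding measurable_cong_sets[OF sets refl] by (rule measurable_restrict_space1)
  qed
  have integrable: "integrable \<eta> (f r)" for r
  proof -
    \<comment> \<open>The finiteness assumption on \<open>\<eta>\<close> concerns symmetric strips,
      so the window from \<open>c\<close> to \<open>d\<close> is enclosed in one.\<close>
    define \<epsilon> where "\<epsilon> = min c (1 - d)"
    have \<epsilon>: "\<epsilon> > 0" "\<epsilon> \<le> c" "d \<le> 1 - \<epsilon>" using cd by (auto simp: \<epsilon>_def)
    have "bounded (\<phi> ` {c..d})"
      by (intro compact_imp_bounded compact_continuous_image continuous_on_subset[OF \<phi>(1)]) auto
    then obtain B where B: "\<And>x. x \<in> {c..d} \<Longrightarrow> norm (\<phi> x) \<le> B"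
      unfolding bounded_iff by blast
    have B': "norm (f r p) \<le> max B 0" for p
      using B[of "snd p"] \<phi>(3)[of "snd p"]
      by (cases "snd p \<in> {c<..<d}") (auto simp: f_def indicator_def)
    \<comment> \<open>Finiteness is available for positive times only, hence \<open>max r 1\<close>;
      the bound \<open>max B 0\<close> also covers points outside the window, where the integrand is
      zero.\<close>
    show ?thesis
    proof (rule integrableI_bounded_set[where A="{0..max r 1} \<times> {\<epsilon><..<1 - \<epsilon>}" and B="max B 0"])
      show "AE p in \<eta>. p \<notin> {0..max r 1} \<times> {\<epsilon><..<1 - \<epsilon>} \<longrightarrow> f r p = 0"
      proof (intro AE_I2 impI)
        fix p :: "real \<times> real" assume p: "p \<notin> {0..max r 1} \<times> {\<epsilon><..<1 - \<epsilon>}"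
        show "f r p = 0"
        proof (cases "snd p \<in> {c<..<d}")
          case True
          then have "\<not> fst p \<in> {0..r}" using p \<epsilon> by (auto simp: mem_Times_iff)
          then show ?thesis by (auto simp: f_def mem_Times_iff)
        qed (simp add: f_def \<phi>(3))
      qed
    qed (use meas \<epsilon> finite in_sets B' in auto)
  qed
  show "(LINT p:{0..s} \<times> {0<..<1}|\<eta>. \<phi> (snd p)) \<le> (LINT p:{0..t} \<times> {0<..<1}|\<eta>. \<phi> (snd p))"
    unfolding set_lebesgue_integral_def f_def[symmetric]
    by (rule integral_mono[OF integrable integrable]) (use s \<phi>(2) in \<open>auto simp: f_def indicator_def\<close>)
  show "(LINT p:{0..s} \<times> {0<..<1}|\<eta>. \<phi> (snd p)) = (LINT p:{0..t} \<times> {0<..<1}|\<eta>. \<phi> (snd p))"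
    if Vcont: "continuous_on ({0..} \<times> {0..1}) (\<lambda>(t, x). V t x)"
      and pos: "\<And>u x. u \<in> {s..t} \<Longrightarrow> x \<in> {c<..<d} \<Longrightarrow> Z u x + V u x > 0"
  proof -
    have "continuous_on ({0..} \<times> {0<..<1}) (\<lambda>p. (\<lambda>(t, x). Z t x) p + (\<lambda>(t, x). V t x) p)"
      by (intro continuous_on_add continuous_on_subset[OF Zcont] continuous_on_subset[OF Vcont]) auto
    then have "(\<lambda>p. Z (fst p) (snd p) + V (fst p) (snd p)) \<in> borel_measurable (restrict_space borel ({0..} \<times> {0<..<1}))"
      by (intro borel_measurable_continuous_on_restrict) (simp add: case_prod_beta)
    then have "(\<lambda>p. Z (fst p) (snd p) + V (fst p) (snd p)) \<in> borel_measurable \<eta>"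
      unfolding measurable_cong_sets[OF sets refl] .
    then have "(\<lambda>p. ennreal (Z (fst p) (snd p) + V (fst p) (snd p)) * indicator ({0..t} \<times> {0<..<1}) p) \<in> borel_measurable \<eta>"
      using in_sets[of 0 1 t] by measurable
    then have "AE p in \<eta>. ennreal (Z (fst p) (snd p) + V (fst p) (snd p)) * indicator ({0..t} \<times> {0<..<1}) p = 0"
      using compl by (simp add: nn_integral_0_iff_AE)
    \<comment> \<open>The two integrands differ only at times in \<open>(s, t]\<close> and points of
      the window, where positivity of \<open>Z + V\<close> contradicts the almost-everywhere
      equation.\<close>
    then have "AE p in \<eta>. f s p = f t p"
    proof eventually_elim
      case (elim p)
      have "\<phi> (snd p) = 0" if "fst p \<in> {s<..t}" "snd p \<in> {0<..<1}"
      proof (rule \<phi>(3), rule notI)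
        assume "snd p \<in> {c<..<d}"
        then have "Z (fst p) (snd p) + V (fst p) (snd p) > 0" using that by (intro pos) auto
        moreover have "p \<in> {0..t} \<times> {0<..<1}" using that s by (auto simp: mem_Times_iff)
        ultimately show False using elim by (auto simp: ennreal_eq_0_iff)
      qed
      then show ?case using s by (auto simp: f_def indicator_def mem_Times_iff)
    qed
    then have "integral\<^sup>L \<eta> (f s) = integral\<^sup>L \<eta> (f t)"
      by (intro integral_cong_AE meas)
    then show ?thesis by (simp add: set_lebesgue_integral_def f_def[abs_def])
  qed
qed

section \<open>Mollification in space\<close>

lemma bump_shift_has_integral:
  fixes \<phi> :: "real \<Rightarrow> real"
  assumes "(\<phi> has_integral 1) {-\<delta>..\<delta>}" and "\<And>z. \<bar>z\<bar> \<ge> \<delta> \<Longrightarrow> \<phi> z = 0"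
    and "\<delta> \<le> y" "y \<le> 1 - \<delta>"
  shows "((\<lambda>x. \<phi> (x - y)) has_integral 1) {0..1}"
proof (rule has_integral_on_superset)
  show "((\<lambda>x. \<phi> (x - y)) has_integral 1) {-\<delta>+y..\<delta>+y}"
    using has_integral_shift_real_ivl[OF assms(1), of "-y"] by simp
qed (use assms in auto)

text \<open>The shifted bump is a probability density on \<open>[0,1]\<close>, since its window
  stays inside, so averaging preserves the bound. The constant \<open>c\<close> is arbitrary because
  \<open>z\<close> will later be compared with a value of \<open>Z\<close> at another time and
  point.\<close>

lemma mollification_close:
  fixes \<phi> z :: "real \<Rightarrow> real"
  assumes z: "continuous_on {0..1} z"
    and \<phi>: "continuous_on UNIV \<phi>" "\<And>x. \<phi> x \<ge> 0" "\<And>x. \<bar>x\<bar> \<ge> \<delta> \<Longrightarrow> \<phi> x = 0"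
      "(\<phi> has_integral 1) {-\<delta>..\<delta>}"
    and y: "\<delta> \<le> y" "y \<le> 1 - \<delta>"
    and close: "\<And>x. x \<in> {0..1} \<Longrightarrow> \<bar>x - y\<bar> < \<delta> \<Longrightarrow> \<bar>z x - c\<bar> \<le> \<epsilon>"
  shows "\<bar>integral {0..1} (\<lambda>x. z x * \<phi> (x - y)) - c\<bar> \<le> \<epsilon>"
proof -
  have one: "((\<lambda>x. \<phi> (x - y)) has_integral 1) {0..1}"
    by (rule bump_shift_has_integral[OF \<phi>(4,3) y])
  have "continuous_on {0..1} (\<lambda>x. z x * \<phi> (x - y))"
    by (intro continuous_intros z continuous_on_compose2[OF \<phi>(1)]) auto
  then have "((\<lambda>x. z x * \<phi> (x - y)) has_integral integral {0..1} (\<lambda>x. z x * \<phi> (x - y))) {0..1}"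
    by (intro integrable_integral integrable_continuous_interval)
  note I = has_integral_diff[OF this has_integral_mult_right[OF one, of c]]
  have "\<bar>integral {0..1} (\<lambda>x. z x * \<phi> (x - y) - c * \<phi> (x - y))\<bar> \<le> integral {0..1} (\<lambda>x. \<epsilon> * \<phi> (x - y))"
    unfolding real_norm_def[symmetric]
  proof (rule integral_norm_bound_integral)
    fix x :: real assume x: "x \<in> {0..1}"
    show "norm (z x * \<phi> (x - y) - c * \<phi> (x - y)) \<le> \<epsilon> * \<phi> (x - y)"
    proof (cases "\<bar>x - y\<bar> < \<delta>")
      case True
      have "\<bar>z x - c\<bar> * \<phi> (x - y) \<le> \<epsilon> * \<phi> (x - y)"
        by (intro mult_right_mono close x True \<phi>)
      then show ?thesis using \<phi>(2)[of "x - y"] by (simp add: abs_mult flip: left_diff_distrib)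
    qed (simp add: \<phi>(3))
  qed (use I has_integral_mult_right[OF one, of \<epsilon>] in \<open>auto simp: has_integral_iff\<close>)
  also have "\<dots> = \<epsilon>" using has_integral_mult_right[OF one, of \<epsilon>] by (simp add: has_integral_iff)
  finally show ?thesis using I by (simp add: has_integral_iff)
qed

text \<open>Differences in the centre \<open>y\<close> fall on the kernel, so no differentiability
  of \<open>z\<close> is required: the pointwise estimate for the bump is integrated against
  \<open>z\<close>, bounded by \<open>M\<close>.\<close>

lemma mollification_second_difference:
  fixes \<phi> \<phi>' \<phi>'' z :: "real \<Rightarrow> real"
  assumes z: "continuous_on {0..1} z" "\<And>x. x \<in> {0..1} \<Longrightarrow> \<bar>z x\<bar> \<le> M"
    and \<phi>: "\<And>x. (\<phi> has_real_derivative \<phi>' x) (at x)"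
    and \<phi>': "\<And>x. (\<phi>' has_real_derivative \<phi>'' x) (at x)"
    and cont: "continuous_on UNIV \<phi>''"
    and h: "h > 0" and \<omega>: "\<And>v w. \<bar>v - w\<bar> \<le> h \<Longrightarrow> \<bar>\<phi>'' v - \<phi>'' w\<bar> \<le> \<omega>"
  defines "m \<equiv> \<lambda>y. integral {0..1} (\<lambda>x. z x * \<phi> (x - y))"
  shows "\<bar>m (y + h) - 2 * m y + m (y - h) - h\<^sup>2 * integral {0..1} (\<lambda>x. z x * \<phi>'' (x - y))\<bar>
    \<le> h\<^sup>2 * (\<omega> * M)"
proof -
  have "M \<ge> 0" using z(2)[of 0] by simp
  have "\<omega> \<ge> 0" using \<omega>[of 0 0] h by simp
  have c\<phi>: "continuous_on UNIV \<phi>"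
    by (rule DERIV_continuous_on) (use \<phi> in \<open>blast intro: has_field_derivative_at_within\<close>)
  have i: "(\<lambda>x. z x * \<phi> (x - y)) integrable_on {0..1}" for y
    by (intro integrable_continuous_interval continuous_intros z continuous_on_compose2[OF c\<phi>]) auto
  have i'': "(\<lambda>x. z x * \<phi>'' (x - y)) integrable_on {0..1}"
    by (intro integrable_continuous_interval continuous_intros z continuous_on_compose2[OF cont]) auto
  have I: "((\<lambda>x. z x * \<phi> (x - (y + h)) - 2 * (z x * \<phi> (x - y)) + z x * \<phi> (x - (y - h))
       - h\<^sup>2 * (z x * \<phi>'' (x - y))) has_integral
     (m (y + h) - 2 * m y + m (y - h) - h\<^sup>2 * integral {0..1} (\<lambda>x. z x * \<phi>'' (x - y)))) {0..1}"
    unfolding m_def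
    by (intro has_integral_diff has_integral_add has_integral_mult_right integrable_integral i i'')
  have "\<bar>m (y + h) - 2 * m y + m (y - h) - h\<^sup>2 * integral {0..1} (\<lambda>x. z x * \<phi>'' (x - y))\<bar>
      \<le> integral {0..1} (\<lambda>x::real. h\<^sup>2 * (\<omega> * M))"
    unfolding integral_unique[OF I, symmetric] real_norm_def[symmetric]
  proof (rule integral_norm_bound_integral)
    fix x :: real assume x: "x \<in> {0..1}"
    have "\<bar>\<phi> (x - y + h) - 2 * \<phi> (x - y) + \<phi> (x - y - h) - h\<^sup>2 * \<phi>'' (x - y)\<bar> \<le> h\<^sup>2 * \<omega>"
      by (rule second_difference_estimate[OF \<phi> \<phi>' h]) (use \<omega> in auto)
    then have "\<bar>z x\<bar> * \<bar>\<phi> (x - y + h) - 2 * \<phi> (x - y) + \<phi> (x - y - h) - h\<^sup>2 * \<phi>'' (x - y)\<bar> \<le> M * (h\<^sup>2 * \<omega>)"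
      using z(2)[OF x] \<open>M \<ge> 0\<close> by (intro mult_mono) auto
    \<comment> \<open>Moving the centre by \<open>h\<close> moves the argument of
      \<open>\<phi>\<close> by \<open>-h\<close>; the outer terms exchange places and the symmetric
      second difference is unchanged.\<close>
    moreover have "z x * \<phi> (x - (y + h)) - 2 * (z x * \<phi> (x - y)) + z x * \<phi> (x - (y - h)) - h\<^sup>2 * (z x * \<phi>'' (x - y))
      = z x * (\<phi> (x - y + h) - 2 * \<phi> (x - y) + \<phi> (x - y - h) - h\<^sup>2 * \<phi>'' (x - y))"
    proof -
      have "x - (y + h) = x - y - h" "x - (y - h) = x - y + h" by simp_all
      then show ?thesis by (simp only: algebra_simps)
    qed
    ultimately show "norm (z x * \<phi> (x - (y + h)) - 2 * (z x * \<phi> (x - y)) + z x * \<phi> (x - (y - h))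
        - h\<^sup>2 * (z x * \<phi>'' (x - y))) \<le> h\<^sup>2 * (\<omega> * M)"
      by (simp add: abs_mult mult_ac)
  qed (use I in \<open>auto simp: has_integral_iff\<close>)
  then show ?thesis by simp
qed

text \<open>The inequalities on \<open>y\<close> are strict because the closed support, contained in
  \<open>[y - \<delta>, y + \<delta>]\<close>, has to lie in the open interval.\<close>

lemma shifted_bump_in_C2_0:
  fixes \<phi> \<phi>' \<phi>'' :: "real \<Rightarrow> real"
  assumes \<phi>: "\<And>x. (\<phi> has_real_derivative \<phi>' x) (at x)"
    and \<phi>': "\<And>x. (\<phi>' has_real_derivative \<phi>'' x) (at x)"
    and cont: "continuous_on UNIV \<phi>''"
    and supp: "\<And>x. \<bar>x\<bar> \<ge> \<delta> \<Longrightarrow> \<phi> x = 0"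
    and y: "\<delta> < y" "y < 1 - \<delta>"
  shows shifted_bump_mem: "(\<lambda>x. \<phi> (x - y)) \<in> C2_0"
    and shifted_bump_deriv2: "deriv (deriv (\<lambda>x. \<phi> (x - y))) = (\<lambda>x. \<phi>'' (x - y))"
proof -
  have d: "((\<lambda>x. \<phi> (x - y)) has_real_derivative \<phi>' (x - y)) (at x)" for x
    using DERIV_shift[of \<phi> "\<phi>' (x - y)" x "- y"] \<phi>[of "x - y"] by simp
  have d': "((\<lambda>x. \<phi>' (x - y)) has_real_derivative \<phi>'' (x - y)) (at x)" for x
    using DERIV_shift[of \<phi>' "\<phi>'' (x - y)" x "- y"] \<phi>'[of "x - y"] by simp
  have e: "deriv (\<lambda>x. \<phi> (x - y)) = (\<lambda>x. \<phi>' (x - y))"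
    by (rule ext) (rule DERIV_imp_deriv[OF d])
  show e': "deriv (deriv (\<lambda>x. \<phi> (x - y))) = (\<lambda>x. \<phi>'' (x - y))"
    unfolding e by (rule ext) (rule DERIV_imp_deriv[OF d'])
  have "{x. \<phi> (x - y) \<noteq> 0} \<subseteq> {y - \<delta>..y + \<delta>}"
    using supp by (auto simp: abs_le_iff) (smt (verit) supp)+
  then have cl: "closure {x. \<phi> (x - y) \<noteq> 0} \<subseteq> {y - \<delta>..y + \<delta>}"
    by (rule closure_minimal) simp
  show "(\<lambda>x. \<phi> (x - y)) \<in> C2_0"
    unfolding C2_0_def mem_Collect_eq e' unfolding e
  proof (intro conjI allI)
    show "(\<lambda>x. \<phi> (x - y)) field_differentiable at x" "(\<lambda>x. \<phi>' (x - y)) field_differentiable at x" for x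
      using d d' unfolding field_differentiable_def by blast+
    show "continuous_on UNIV (\<lambda>x. \<phi>'' (x - y))"
      by (intro continuous_on_compose2[OF cont] continuous_intros) auto
    show "compact (closure {x. \<phi> (x - y) \<noteq> 0})"
      by (rule compact_closure[THEN iffD2], rule bounded_subset[OF _ order_trans[OF closure_subset cl]]) simp
    show "closure {x. \<phi> (x - y) \<noteq> 0} \<subseteq> {0<..<1}"
      using cl y by fastforce
  qed
qed

lemma continuous_on_parametric_integral:
  fixes Z :: "real \<Rightarrow> real \<Rightarrow> real"
  assumes Z: "continuous_on ({0..} \<times> {0..1}) (\<lambda>(t, x). Z t x)" and f: "continuous_on {0..1} f"
    and g: "continuous_on S g" "g ` S \<subseteq> {0..}"
  shows "continuous_on S (\<lambda>s. integral {0..1} (\<lambda>x. Z (g s) x * f x))"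
proof -
  have "continuous_on ({0..} \<times> {0..1}) (\<lambda>p. (\<lambda>(t, x). Z t x) p * f (snd p))"
    by (intro continuous_on_mult Z continuous_on_compose2[OF f] continuous_intros) auto
  then have "continuous_on ({0..} \<times> cbox 0 1) (\<lambda>(t, x). Z t x * f x)"
    by (simp add: case_prod_beta)
  from integral_continuous_on_param[OF this]
  have "continuous_on {0..} (\<lambda>s. integral {0..1} (\<lambda>x. Z s x * f x))" by simp
  from continuous_on_compose2[OF this g] show ?thesis .
qed

text \<open>Substituting \<open>s\<close> by \<open>c * s\<close> in the time integral puts a factor
  \<open>c\<close> before the second-derivative term. This factor will match the square of the
  spatial contraction ratio.\<close>

lemma obstacle_weak_rescaled:
  fixes \<phi> :: "real \<Rightarrow> real"
  assumes sol: "obstacle_solution V Z \<eta>" and \<phi>: "\<phi> \<in> C2_0" and c: "c > 0" and t: "t \<ge> 0"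
  shows "integral {0..1} (\<lambda>x. Z (c * t) x * \<phi> x)
    = integral {0..t} (\<lambda>s. c * integral {0..1} (\<lambda>x. Z (c * s) x * deriv (deriv \<phi>) x))
      + (LINT p:{0..c * t} \<times> {0<..<1}|\<eta>. \<phi> (snd p))"
proof -
  have "(\<lambda>s. s / c) ` {0..c * t} = {0..t}"
    using c t by (auto simp: image_iff field_simps intro!: bexI[of _ "c * _"])
  then have "integral {0..t} (\<lambda>s. integral {0..1} (\<lambda>x. Z (c * s) x * deriv (deriv \<phi>) x))
     = (1 / c) * integral {0..c * t} (\<lambda>s. integral {0..1} (\<lambda>x. Z s x * deriv (deriv \<phi>) x))"
    using integral_stretch_real[of c 0 "c * t" "\<lambda>s. integral {0..1} (\<lambda>x. Z s x * deriv (deriv \<phi>) x)"] c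
    by simp
  moreover have "integral {0..1} (\<lambda>x. Z (c * t) x * \<phi> x)
          - integral {0..c * t} (\<lambda>s. integral {0..1} (\<lambda>x. Z s x * deriv (deriv \<phi>) x))
        = (LINT p:{0..c * t} \<times> {0<..<1}|\<eta>. \<phi> (snd p))"
    using sol \<phi> c t unfolding obstacle_solution_def by auto
  ultimately show ?thesis using c by simp
qed

lemma uniform_modulus:
  fixes f :: "real \<Rightarrow> real \<Rightarrow> real"
  assumes f: "continuous_on ({0..} \<times> {0..1}) (\<lambda>(t, x). f t x)" and "e > 0"
  obtains \<rho> where "\<rho> > 0"
    "\<And>t x t' x'. t \<in> {0..T} \<Longrightarrow> t' \<in> {0..T} \<Longrightarrow> x \<in> {0..1} \<Longrightarrow> x' \<in> {0..1} \<Longrightarrow>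
       \<bar>t - t'\<bar> < \<rho> \<Longrightarrow> \<bar>x - x'\<bar> < \<rho> \<Longrightarrow> \<bar>f t x - f t' x'\<bar> < e"
proof -
  have "uniformly_continuous_on ({0..T} \<times> {0..1}) (\<lambda>(t, x). f t x)"
    by (intro compact_uniformly_continuous continuous_on_subset[OF f] compact_Times) auto
  then obtain d where d: "d > 0" "\<And>p q. p \<in> {0..T} \<times> {0..1} \<Longrightarrow> q \<in> {0..T} \<times> {0..1} \<Longrightarrow> dist q p < d \<Longrightarrow>
     dist ((\<lambda>(t, x). f t x) q) ((\<lambda>(t, x). f t x) p) < e"
    using \<open>e > 0\<close> unfolding uniformly_continuous_on_def by metis
  show ?thesis
  proof (rule that[of "d / 2"])
    fix t x t' x' :: real
    assume a: "t \<in> {0..T}" "t' \<in> {0..T}" "x \<in> {0..1}" "x' \<in> {0..1}" "\<bar>t - t'\<bar> < d / 2" "\<bar>x - x'\<bar> < d / 2"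
    have "dist (t, x) (t', x') \<le> \<bar>t - t'\<bar> + \<bar>x - x'\<bar>"
      using sqrt_sum_squares_le_sum_abs[of "t - t'" "x - x'"] by (simp add: dist_Pair_Pair dist_real_def)
    then have "dist (t, x) (t', x') < d" using a by linarith
    then show "\<bar>f t x - f t' x'\<bar> < e"
      using d(2)[of "(t', x')" "(t, x)"] a by (simp add: dist_real_def)
  qed (use d in simp)
qed

section \<open>Convergence\<close>

text \<open>The error budget is \<open>3 * e1 + 3 * e * T\<close> between the discrete solution and
  the mollification \<open>W\<close>, and \<open>e1\<close> between \<open>W\<close> and
  \<open>Z\<close>: at most \<open>3 / 4 * \<epsilon>\<close> in total. The bump is fixed before the
  mesh, so the mesh can be taken fine relative to the oscillation of
  \<open>\<phi>''\<close>.\<close>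

lemma skorohod_grid_estimate:
  assumes V: "continuous_on ({0..} \<times> {0..1}) (\<lambda>(t, x). V t x)"
    and sol: "obstacle_solution V Z \<eta>"
    and skor: "\<And>n. n \<ge> 2 \<Longrightarrow> skorohod_solution V n (Zn n) (\<eta>n n)"
    and T: "T > 0" and \<epsilon>: "\<epsilon> > 0"
  shows "\<exists>N\<ge>2. \<forall>n\<ge>N. \<forall>k\<le>n. \<forall>t\<in>{0..T}. \<bar>zero_bdry n (Zn n) k t - Z t (real k / real n)\<bar> \<le> \<epsilon>"
proof -
  have Zcont: "continuous_on ({0..} \<times> {0..1}) (\<lambda>(t, x). Z t x)"
    and Z0: "\<And>x. x \<in> {0..1} \<Longrightarrow> Z 0 x = 0"
    and Zb: "\<And>t. t \<ge> 0 \<Longrightarrow> Z t 0 = 0" "\<And>t. t \<ge> 0 \<Longrightarrow> Z t 1 = 0"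
    and ZV: "\<And>t x. t \<ge> 0 \<Longrightarrow> x \<in> {0..1} \<Longrightarrow> Z t x \<ge> - V t x"
    using sol unfolding obstacle_solution_def by blast+
  define e1 where "e1 = \<epsilon> / 8"
  have e1: "e1 > 0" using \<epsilon> by (simp add: e1_def)
  obtain \<rho>1 where \<rho>1: "\<rho>1 > 0"
    "\<And>t x t' x'. t \<in> {0..T} \<Longrightarrow> t' \<in> {0..T} \<Longrightarrow> x \<in> {0..1} \<Longrightarrow> x' \<in> {0..1} \<Longrightarrow>
       \<bar>t - t'\<bar> < \<rho>1 \<Longrightarrow> \<bar>x - x'\<bar> < \<rho>1 \<Longrightarrow> \<bar>Z t x - Z t' x'\<bar> < e1"
    using uniform_modulus[OF Zcont e1] by blast
  obtain \<rho>2 where \<rho>2: "\<rho>2 > 0"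
    "\<And>t x t' x'. t \<in> {0..T} \<Longrightarrow> t' \<in> {0..T} \<Longrightarrow> x \<in> {0..1} \<Longrightarrow> x' \<in> {0..1} \<Longrightarrow>
       \<bar>t - t'\<bar> < \<rho>2 \<Longrightarrow> \<bar>x - x'\<bar> < \<rho>2 \<Longrightarrow> \<bar>V t x - V t' x'\<bar> < e1"
    using uniform_modulus[OF V e1] by blast
  define \<rho> where "\<rho> = min \<rho>1 \<rho>2"
  have \<rho>: "\<rho> > 0" "\<rho> \<le> \<rho>1" "\<rho> \<le> \<rho>2" using \<rho>1(1) \<rho>2(1) by (auto simp: \<rho>_def)
  \<comment> \<open>The time shift is at most \<open>4 * a * T\<close> and the spatial displacement
    stays below \<open>2 * a\<close>; this choice puts both under \<open>\<rho>\<close>. The bound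
    \<open>1 / 4\<close> keeps the contraction ratio \<open>r\<close> positive.\<close>
  define a where "a = min (1 / 4) (\<rho> / (4 * (T + 1)))"
  have a: "a > 0" using \<rho> T by (simp add: a_def)
  have a4: "a \<le> 1 / 4" unfolding a_def by (rule min.cobounded1)
  have "a \<le> \<rho> / (4 * (T + 1))" unfolding a_def by (rule min.cobounded2)
  then have "a * (4 * (T + 1)) \<le> \<rho>" using T by (simp add: pos_le_divide_eq)
  then have a\<rho>: "4 * a * T + 4 * a \<le> \<rho>" by (simp add: algebra_simps)
  have aT: "4 * a * T > 0" using a T by simp
  \<comment> \<open>Parabolic scaling forces \<open>c\<close> to be the square of \<open>r\<close>.
    A half-width \<open>\<delta>\<close> below \<open>a\<close> keeps every bump centred in
    \<open>[a, 1 - a]\<close> inside \<open>(0,1)\<close>.\<close>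
  define r where "r = 1 - 2 * a"
  define c where "c = r\<^sup>2"
  define \<delta> where "\<delta> = a / 2"
  have r: "r > 0" "r \<le> 1" using a a4 by (auto simp: r_def)
  have c: "c > 0" "c \<le> 1" using r by (auto simp: c_def power_le_one)
  have ct: "c * t \<in> {0..T}" if "t \<in> {0..T}" for t
  proof -
    have "c * t \<le> 1 * t" using c that by (intro mult_right_mono) auto
    then show ?thesis using that c by auto
  qed
  have c1: "1 - c \<le> 4 * a" by (simp add: c_def r_def power2_eq_square algebra_simps)
  have time: "\<bar>c * t - t\<bar> < \<rho>" if "t \<in> {0..T}" for t
  proof -
    have "(1 - c) * t \<le> 4 * a * T" using c1 c that a by (intro mult_mono) auto
    moreover have "(1 - c) * t \<ge> 0" using c that by simp
    moreover have "\<bar>c * t - t\<bar> = \<bar>(1 - c) * t\<bar>" by (simp add: algebra_simps abs_minus_commute)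
    ultimately show ?thesis using a\<rho> a by linarith
  qed
  have \<delta>: "\<delta> > 0" "\<delta> < a" using a by (auto simp: \<delta>_def)
  obtain \<phi> \<phi>' \<phi>'' where
    \<phi>: "\<And>z. (\<phi> has_real_derivative \<phi>' z) (at z)"
    and \<phi>': "\<And>z. (\<phi>' has_real_derivative \<phi>'' z) (at z)"
    and uc: "uniformly_continuous_on UNIV \<phi>''"
    and nonneg: "\<And>z. \<phi> z \<ge> 0" and supp: "\<And>z. \<bar>z\<bar> \<ge> \<delta> \<Longrightarrow> \<phi> z = 0"
    and one: "(\<phi> has_integral 1) {-\<delta>..\<delta>}"
    using C2_bump_exists[OF \<delta>(1)] by metis
  have cont'': "continuous_on UNIV \<phi>''" by (rule uniformly_continuous_imp_continuous[OF uc])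
  have cont: "continuous_on UNIV \<phi>"
    by (rule DERIV_continuous_on) (use \<phi> in \<open>blast intro: has_field_derivative_at_within\<close>)
  have "bounded ((\<lambda>(t, x). Z t x) ` ({0..T} \<times> {0..1}))"
    by (intro compact_imp_bounded compact_continuous_image compact_Times continuous_on_subset[OF Zcont]) auto
  then obtain M where "\<forall>z\<in>(\<lambda>(t, x). Z t x) ` ({0..T} \<times> {0..1}). norm z \<le> M"
    unfolding bounded_iff by blast
  then have M: "\<bar>Z t x\<bar> \<le> M" if "t \<in> {0..T}" "x \<in> {0..1}" for t x
    using that by force
  have "M \<ge> 0" using M[of 0 0] T by auto
  define e where "e = \<epsilon> / (12 * (T + 1))"
  have e: "e > 0" using \<epsilon> T by (simp add: e_def)
  have eT: "3 * e * T \<le> \<epsilon> / 4"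
  proof -
    have "3 * e * T \<le> 3 * e * (T + 1)" using e by simp
    also have "\<dots> = \<epsilon> / 4" using T by (simp add: e_def field_simps)
    finally show ?thesis .
  qed
  \<comment> \<open>The denominator \<open>M + 1\<close> avoids division by zero and still gives
    \<open>\<omega> * M \<le> e\<close>.\<close>
  define \<omega> where "\<omega> = e / (M + 1)"
  have \<omega>: "\<omega> > 0" "\<omega> * M \<le> e"
    using e \<open>M \<ge> 0\<close> by (auto simp: \<omega>_def field_simps)
  obtain d where d: "d > 0" "\<And>v w. \<bar>v - w\<bar> < d \<Longrightarrow> \<bar>\<phi>'' v - \<phi>'' w\<bar> < \<omega>"
    using uc \<omega>(1) unfolding uniformly_continuous_on_def dist_real_def by (metis UNIV_I)
  obtain N0 :: nat where N0: "1 / d < real N0" using reals_Archimedean2 by blast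
  define N where "N = max N0 2"
  have "\<bar>zero_bdry n (Zn n) k t - Z t (real k / real n)\<bar> \<le> \<epsilon>"
    if n: "n \<ge> N" and k: "k \<le> n" and t: "t \<in> {0..T}" for n k t
  proof -
    have n2: "n \<ge> 2" "n \<ge> N0" using n by (auto simp: N_def)
    define h where "h = r / real n"
    have "1 < d * real N0" using N0 d(1) by (simp add: field_simps)
    also have "\<dots> \<le> d * real n" using d n2 by simp
    finally have h: "h > 0" "h < d" using r n2 by (auto simp: h_def field_simps)
    have hn: "h * real n = r" using n2 by (simp add: h_def)
    \<comment> \<open>The contracted nodes have spacing \<open>h\<close>, while the discrete
      equation carries the factor \<open>(real n)\<^sup>2\<close>; the product is exactly the
      time-scaling factor \<open>c\<close>.\<close>
    then have nh: "(real n)\<^sup>2 * h\<^sup>2 = c" by (simp add: c_def mult.commute flip: power_mult_distrib)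
    define y where "y k = a + h * real k" for k
    have y: "y k \<in> {a..1 - a}" if "k \<le> n" for k
    proof -
      have "h * real k \<le> h * real n" using that h by simp
      then show ?thesis using h hn by (simp add: y_def r_def)
    qed
    have yk: "\<bar>y k - real k / real n\<bar> \<le> a" if "k \<le> n" for k
    proof -
      have "y k - real k / real n = a * (1 - 2 * (real k / real n))"
        using n2 by (simp add: y_def h_def r_def field_simps)
      moreover have "\<bar>1 - 2 * (real k / real n)\<bar> \<le> 1" using that n2 by (auto simp: abs_le_iff field_simps)
      ultimately show ?thesis using a by (simp add: abs_mult mult_left_le)
    qed
    have grid: "real k / real n \<in> {0..1}" if "k \<le> n" for k
      using that n2 by (auto simp: field_simps)
    have near: "\<bar>x - real k / real n\<bar> < \<rho>" if "k \<le> n" "\<bar>x - y k\<bar> < \<delta>" for k x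
      using yk[OF that(1)] that(2) \<delta> a a\<rho> aT by linarith
    have Znear: "\<bar>Z (c * t) x - Z t (real k / real n)\<bar> < e1"
      and Vnear: "\<bar>V (c * t) x - V t (real k / real n)\<bar> < e1"
      if "k \<le> n" "t \<in> {0..T}" "x \<in> {0..1}" "\<bar>x - y k\<bar> < \<delta>" for k t x
      using \<rho>1(2)[of "c * t" t x "real k / real n"] \<rho>2(2)[of "c * t" t x "real k / real n"]
        ct[OF that(2)] time[OF that(2)] near[OF that(1,4)] grid[OF that(1)] that \<rho> by auto
    \<comment> \<open>\<open>W\<close> is the contracted, mollified \<open>Z\<close> at the nodes,
      \<open>G\<close> its drift and \<open>b\<close> its reflection term.\<close>
    define W where "W k t = integral {0..1} (\<lambda>x. Z (c * t) x * \<phi> (x - y k))" for k t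
    define G where "G k t = c * integral {0..1} (\<lambda>x. Z (c * t) x * \<phi>'' (x - y k))" for k t
    define b where "b k t = (LINT p:{0..c * t} \<times> {0<..<1}|\<eta>. \<phi> (snd p - y k))" for k t
    have Zslice: "continuous_on {0..1} (Z s)" if "s \<ge> 0" for s
    proof -
      have "continuous_on {0..1} (\<lambda>x. (s, x))" by (intro continuous_intros)
      from continuous_on_compose2[OF Zcont this] that show ?thesis by auto
    qed
    have WZ: "\<bar>W k t - Z t (real k / real n)\<bar> \<le> e1" if "k \<le> n" "t \<in> {0..T}" for k t
      unfolding W_def
    proof (rule mollification_close[OF _ cont nonneg supp one])
      show "continuous_on {0..1} (Z (c * t))" using ct[OF that(2)] by (intro Zslice) auto
    qed (use y[OF that(1)] \<delta> Znear[OF that] in \<open>auto intro: less_imp_le\<close>)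
    have scale: "continuous_on {0..T} (\<lambda>t. c * t)" "(\<lambda>t. c * t) ` {0..T} \<subseteq> {0..}"
      using c by (auto intro!: continuous_intros)
    have contW: "continuous_on {0..T} (W k)" for k
      unfolding W_def[abs_def]
      by (intro continuous_on_parametric_integral[OF Zcont _ scale] continuous_on_compose2[OF cont] continuous_intros) auto
    have contG: "continuous_on {0..T} (G k)" for k
      unfolding G_def[abs_def]
      by (intro continuous_on_mult continuous_on_const continuous_on_parametric_integral[OF Zcont _ scale]
            continuous_on_compose2[OF cont''] continuous_on_diff continuous_on_id) auto
    have W: "W k t = integral {0..t} (G k) + b k t" if "k \<le> n" "t \<in> {0..T}" for k t
    proof -
      have y': "\<delta> < y k" "y k < 1 - \<delta>" using y[OF that(1)] \<delta> by auto
      show ?thesis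
        using obstacle_weak_rescaled[OF sol shifted_bump_mem[OF \<phi> \<phi>' cont'' supp y'] c(1), of t]
          shifted_bump_deriv2[OF \<phi> \<phi>' cont'' supp y'] that(2)
        by (simp add: W_def G_def[abs_def] b_def)
    qed
    have GW: "\<bar>G k t - (real n)\<^sup>2 * (W (k + 1) t - 2 * W k t + W (k - 1) t)\<bar> \<le> e"
      if k: "0 < k" "k < n" and t: "t \<in> {0..T}" for k t
    proof -
      have "y (k + 1) = y k + h" "y (k - 1) = y k - h"
        using k by (auto simp: y_def algebra_simps of_nat_diff)
      moreover have "\<bar>\<phi>'' v - \<phi>'' w\<bar> \<le> \<omega>" if "\<bar>v - w\<bar> \<le> h" for v w
        using d(2)[of v w] that h by auto
      moreover have "\<bar>Z (c * t) x\<bar> \<le> M" if "x \<in> {0..1}" for x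
        by (rule M[OF ct[OF t] that])
      moreover have "continuous_on {0..1} (Z (c * t))" using ct[OF t] by (intro Zslice) auto
      ultimately have "\<bar>W (k + 1) t - 2 * W k t + W (k - 1) t
          - h\<^sup>2 * integral {0..1} (\<lambda>x. Z (c * t) x * \<phi>'' (x - y k))\<bar> \<le> h\<^sup>2 * (\<omega> * M)"
        unfolding W_def using mollification_second_difference[OF _ _ \<phi> \<phi>' cont'' h(1)] by presburger
      then have "(real n)\<^sup>2 * \<bar>W (k + 1) t - 2 * W k t + W (k - 1) t
          - h\<^sup>2 * integral {0..1} (\<lambda>x. Z (c * t) x * \<phi>'' (x - y k))\<bar> \<le> (real n)\<^sup>2 * (h\<^sup>2 * (\<omega> * M))"
        by (intro mult_left_mono) auto
      also have "\<dots> = c * (\<omega> * M)" using nh by (simp add: mult.assoc[symmetric])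
      also have "\<dots> \<le> 1 * e" using c \<omega> e \<open>M \<ge> 0\<close> by (intro mult_mono) auto
      finally have "\<bar>(real n)\<^sup>2 * (W (k + 1) t - 2 * W k t + W (k - 1) t
          - h\<^sup>2 * integral {0..1} (\<lambda>x. Z (c * t) x * \<phi>'' (x - y k)))\<bar> \<le> e"
        by (simp add: abs_mult)
      also have "(real n)\<^sup>2 * (W (k + 1) t - 2 * W k t + W (k - 1) t
          - h\<^sup>2 * integral {0..1} (\<lambda>x. Z (c * t) x * \<phi>'' (x - y k)))
        = (real n)\<^sup>2 * (W (k + 1) t - 2 * W k t + W (k - 1) t) - G k t"
        unfolding G_def nh[symmetric] by (simp add: algebra_simps)
      finally show ?thesis by (simp add: abs_minus_commute)
    qed
    have Wb: "\<bar>W 0 t\<bar> \<le> e1" "\<bar>W n t\<bar> \<le> e1" if "t \<in> {0..T}" for t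
      using WZ[of 0 t] WZ[of n t] Zb[of t] that n2 by auto
    have W0: "W k 0 = 0" for k
    proof -
      have "integral {0..1} (\<lambda>x. Z (c * 0) x * \<phi> (x - y k)) = integral {0..1} (\<lambda>x::real. 0)"
        by (rule Henstock_Kurzweil_Integration.integral_cong) (simp add: Z0)
      then show ?thesis by (simp add: W_def)
    qed
    have y_window: "0 < y k - \<delta>" "y k + \<delta> < 1" if "k \<le> n" for k
      using y[OF that] \<delta> by auto
    have window_cont: "continuous_on UNIV (\<lambda>x. \<phi> (x - y k))" for k
      by (intro continuous_on_compose2[OF cont] continuous_intros) auto
    have window_zero: "\<phi> (x - y k) = 0" if "x \<notin> {y k - \<delta><..<y k + \<delta>}" for x k
      using that by (intro supp) (auto simp: abs_le_iff not_less)
    have b_mono: "b k s \<le> b k t" if "k \<le> n" "0 \<le> s" "s \<le> t" for k s t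
      unfolding b_def using c that
      by (intro obstacle_reflection_mono[OF sol window_cont nonneg window_zero y_window]) auto
    define X where "X = zero_bdry n (Zn n)"
    define F where "F k s = (real n)\<^sup>2 * (X (k + 1) s - 2 * X k s + X (k - 1) s)" for k s
    note sk = skor[OF n2(1), unfolded skorohod_solution_def]
    have contX: "continuous_on {0..T} (X k)" if "k \<le> n" for k
    proof (cases "k = 0 \<or> k = n")
      case True
      then have "X k = (\<lambda>t. 0)" by (auto simp: X_def zero_bdry_def)
      then show ?thesis by simp
    next
      case False
      then have "k \<in> {1..n-1}" using that by auto
      then have "continuous_on {0..} (Zn n k)" using sk by blast
      then have "continuous_on {0..T} (Zn n k)" by (rule continuous_on_subset) auto
      moreover have "X k = Zn n k" using False by (auto simp: X_def zero_bdry_def)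
      ultimately show ?thesis by simp
    qed
    have Xk: "X k t = Zn n k t" if "0 < k" "k < n" for k t
      using that by (auto simp: X_def zero_bdry_def)
    have XV: "X k t \<ge> - V t (real k / real n)" if "0 < k" "k < n" "t \<ge> 0" for k t
    proof -
      have "k \<in> {1..n-1}" using that by auto
      then show ?thesis using sk that Xk[of k] by auto
    qed
    have XF: "X k t = integral {0..t} (F k) + \<eta>n n k t" if "0 < k" "k < n" "t \<ge> 0" for k t
    proof -
      have k': "k \<in> {1..n-1}" using that by auto
      then have "Zn n k t = integral {0..t} (\<lambda>s. (real n)\<^sup>2 * (\<Sum>i=1..n-1. lap_matrix k i * Zn n i s)) + \<eta>n n k t"
        using sk that by blast
      then show ?thesis
        unfolding skorohod_laplacian[OF k'] using Xk[OF that(1,2), of t] by (simp add: F_def[abs_def] X_def)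
    qed
    have contF: "continuous_on {0..T} (F k)" if "0 < k" "k < n" for k
      unfolding F_def[abs_def] using that by (intro continuous_intros contX) auto
    have \<eta>_mono: "\<eta>n n k s \<le> \<eta>n n k t" if "0 < k" "k < n" "0 \<le> s" "s \<le> t" for k s t
    proof -
      have "k \<in> {1..n-1}" using that by auto
      then have "mono_on {0..} (\<eta>n n k)" using sk by blast
      then show ?thesis by (rule mono_onD) (use that in auto)
    qed
    have Xb: "X 0 t = 0" "X n t = 0" for t by (auto simp: X_def zero_bdry_def)
    have X0: "X k 0 = 0" if "0 < k" "k < n" for k
    proof -
      have "k \<in> {1..n-1}" using that by auto
      then have "\<eta>n n k 0 = 0" using sk by blast
      then show ?thesis using XF[OF that, of 0] by simp
    qed
    have XF': "\<bar>F k t - (real n)\<^sup>2 * (X (k + 1) t - 2 * X k t + X (k - 1) t)\<bar> \<le> e" for k t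
      using e by (simp add: F_def)
    \<comment> \<open>Margin \<open>e1\<close> suffices here: where \<open>X\<close> exceeds
      \<open>W + e1\<close> it exceeds \<open>Z\<close>, hence lies strictly above the obstacle at
      the same node, and the discrete reflection rests.\<close>
    have "X k t \<le> W k t + e1 + 3 * e * T"
    proof (rule discrete_comparison[where X = X and Y = W and F = F and G = G and a = "\<eta>n n" and b = b
          and c = "(real n)\<^sup>2" and n = n])
      fix k s t assume k: "0 < k" "k < n" and s: "0 \<le> s" "s \<le> t" and t: "t \<le> T"
        and above: "\<And>u. u \<in> {s..t} \<Longrightarrow> W k u + e1 < X k u"
      have k': "k \<in> {1..n-1}" using k by auto
      show "\<eta>n n k s = \<eta>n n k t"
      proof (rule skorohod_reflection_flat[OF skor[OF n2(1)] V k' s])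
        fix u assume u: "u \<in> {s..t}"
        then have "u \<in> {0..T}" using s t by auto
        then have "\<bar>W k u - Z u (real k / real n)\<bar> \<le> e1" "Z u (real k / real n) \<ge> - V u (real k / real n)"
          using WZ[of k u] ZV[of u "real k / real n"] grid[of k] k by auto
        then show "0 < Zn n k u + V u (real k / real n)"
          using above[OF u] Xk[OF k, of u] by linarith
      qed
    next
      fix t assume "t \<in> {0..T}"
      then show "X 0 t \<le> W 0 t + e1" "X n t \<le> W n t + e1" using Wb[of t] Xb[of t] by (auto simp: abs_le_iff)
    next
      fix k s t assume "0 < k" "k < n" "0 \<le> s" "s \<le> t" "t \<le> T"
      then show "b k s \<le> b k t" by (intro b_mono) auto
    next
      fix k assume "0 < k" "k < n"
      then show "X k 0 \<le> W k 0 + e1" using W0 X0 e1 by simp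
    qed (rule e zero_le_power2 contX contW contF contG XF W XF' GW k t; simp)+
    \<comment> \<open>The obstacle condition is now needed on the whole window of the bump. One
      \<open>e1\<close> pays for passing from \<open>W\<close> to \<open>Z\<close>, one for moving
      \<open>Z\<close> across the window and the time shift, one for moving \<open>V\<close>
      likewise.\<close>
    moreover have "W k t \<le> X k t + 3 * e1 + 3 * e * T"
    proof (rule discrete_comparison[where X = W and Y = X and F = G and G = F and a = b and b = "\<eta>n n"
          and c = "(real n)\<^sup>2" and n = n])
      fix k s t assume k: "0 < k" "k < n" and s: "0 \<le> s" "s \<le> t" and t: "t \<le> T"
        and above: "\<And>u. u \<in> {s..t} \<Longrightarrow> X k u + 3 * e1 < W k u"
      have kn: "k \<le> n" using k by simp
      show "b k s = b k t"
        unfolding b_def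
      proof (rule obstacle_reflection_flat[OF sol window_cont nonneg window_zero y_window[OF kn] _ _ V])
        fix v x assume v: "v \<in> {c * s..c * t}" and x: "x \<in> {y k - \<delta><..<y k + \<delta>}"
        \<comment> \<open>The measure \<open>\<eta>\<close> lives in the original time
          \<open>v\<close>, the comparison in the slowed time \<open>u\<close>.\<close>
        define u where "u = v / c"
        have vu: "v = c * u" using c by (simp add: u_def)
        then have u: "u \<in> {s..t}" using v c by auto
        then have u': "u \<in> {0..T}" using s t by auto
        have x': "x \<in> {0..1}" "\<bar>x - y k\<bar> < \<delta>" using x y_window[OF kn] by (auto simp: abs_less_iff)
        have "X k u \<ge> - V u (real k / real n)" using XV[OF k] u' by auto
        then show "0 < Z v x + V v x"
          using above[OF u] WZ[OF kn u'] Znear[OF kn u' x'] Vnear[OF kn u' x'] unfolding vu by linarith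
      qed (use c s in auto)
    next
      fix t assume "t \<in> {0..T}"
      then show "W 0 t \<le> X 0 t + 3 * e1" "W n t \<le> X n t + 3 * e1"
        using Wb[of t] Xb[of t] e1 by (auto simp: abs_le_iff)
    next
      fix k assume "0 < k" "k < n"
      then show "W k 0 \<le> X k 0 + 3 * e1" using W0 X0 e1 by simp
    qed (rule e zero_le_power2 contX contW contF contG XF W XF' GW \<eta>_mono k t; simp)+
    ultimately have "\<bar>X k t - W k t\<bar> \<le> 3 * e1 + 3 * e * T" using e1 by linarith
    then show ?thesis
      using WZ[OF k t] eT \<epsilon> unfolding X_def[symmetric] e1_def by linarith
  qed
  then show ?thesis by (intro exI[of _ N]) (auto simp: N_def)
qed

text \<open>The interpolant is a convex combination of two neighbouring node values, both close to
  \<open>f x\<close> because their nodes lie within one mesh width of \<open>x\<close>. The endpoint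
  \<open>x = 1\<close> is separate, as the interpolant is zero there by definition.\<close>

lemma interpolate_close:
  fixes f :: "real \<Rightarrow> real"
  assumes n: "n \<ge> 1" and x: "x \<in> {0..1}" and one: "f 1 = 0"
    and grid: "\<And>k. k \<le> n \<Longrightarrow> \<bar>zero_bdry n Z k t - f (real k / real n)\<bar> \<le> \<epsilon>"
    and f: "\<And>y. y \<in> {0..1} \<Longrightarrow> \<bar>y - x\<bar> \<le> 1 / real n \<Longrightarrow> \<bar>f y - f x\<bar> \<le> \<epsilon>'"
    and nonneg: "\<epsilon> \<ge> 0" "\<epsilon>' \<ge> 0"
  shows "\<bar>interpolate n Z t x - f x\<bar> \<le> \<epsilon> + \<epsilon>'"
proof (cases "x = 1")
  case True
  then show ?thesis using one nonneg by (simp add: interpolate_def)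
next
  case False
  define k where "k = nat \<lfloor>real n * x\<rfloor>"
  define \<theta> where "\<theta> = real n * x - real k"
  have "real k = of_int \<lfloor>real n * x\<rfloor>" using x by (simp add: k_def)
  then have \<theta>: "0 \<le> \<theta>" "\<theta> < 1" unfolding \<theta>_def by linarith+
  \<comment> \<open>Excluding \<open>x = 1\<close> makes \<open>k + 1\<close> at most
    \<open>n\<close>, so both neighbours are covered by \<open>grid\<close>.\<close>
  have "real n * x < real n * 1" using x False n by (intro mult_strict_left_mono) auto
  then have k: "k < n" using \<theta> by (simp add: \<theta>_def)
  have near: "\<bar>zero_bdry n Z j t - f x\<bar> \<le> \<epsilon> + \<epsilon>'" if "j = k \<or> j = k + 1" for j
  proof -
    have "\<bar>real j / real n - x\<bar> \<le> 1 / real n"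
    proof -
      have "\<bar>real j - real n * x\<bar> / real n \<le> 1 / real n"
        using that \<theta> by (intro divide_right_mono) (auto simp: \<theta>_def)
      moreover have "real j / real n - x = (real j - real n * x) / real n"
        using n by (simp add: field_simps)
      ultimately show ?thesis by simp
    qed
    moreover have "real j / real n \<in> {0..1}" using that k by (auto simp: field_simps)
    ultimately have "\<bar>f (real j / real n) - f x\<bar> \<le> \<epsilon>'" by (rule f[rotated])
    moreover have "\<bar>zero_bdry n Z j t - f (real j / real n)\<bar> \<le> \<epsilon>" using that k by (intro grid) auto
    ultimately show ?thesis by linarith
  qed
  have "interpolate n Z t x - f x
     = (1 - \<theta>) * (zero_bdry n Z k t - f x) + \<theta> * (zero_bdry n Z (k + 1) t - f x)"
  proof -
    have "interpolate n Z t x = zero_bdry n Z k t + \<theta> * (zero_bdry n Z (k + 1) t - zero_bdry n Z k t)"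
      using False by (simp add: interpolate_def Let_def \<theta>_def k_def)
    then show ?thesis by (simp add: algebra_simps)
  qed
  also have "\<bar>\<dots>\<bar> \<le> (1 - \<theta>) * \<bar>zero_bdry n Z k t - f x\<bar> + \<theta> * \<bar>zero_bdry n Z (k + 1) t - f x\<bar>"
    using \<theta> by (intro order_trans[OF abs_triangle_ineq]) (simp add: abs_mult)
  also have "\<dots> \<le> (1 - \<theta>) * (\<epsilon> + \<epsilon>') + \<theta> * (\<epsilon> + \<epsilon>')"
    using \<theta> near by (intro add_mono mult_left_mono) auto
  finally show ?thesis by (simp add: algebra_simps)
qed

theorem theorem4p1:
  fixes u0 :: "real \<Rightarrow> real"
    and V Z :: "real \<Rightarrow> real \<Rightarrow> real"
    and \<eta> :: "(real \<times> real) measure"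
    and Zn \<eta>n :: "nat \<Rightarrow> nat \<Rightarrow> real \<Rightarrow> real"
    and T :: real
  assumes "continuous_on {0..1} u0"
    and "\<forall>x\<in>{0..1}. u0 x \<ge> 0"
    and "u0 0 = 0" and "u0 1 = 0"
    and "continuous_on ({0..} \<times> {0..1}) (\<lambda>(t, x). V t x)"
    and "\<forall>x\<in>{0..1}. V 0 x = u0 x"
    and "\<forall>t\<ge>0. V t 0 = 0 \<and> V t 1 = 0"
    and "obstacle_solution V Z \<eta>"
    and "\<forall>n\<ge>2. skorohod_solution V n (Zn n) (\<eta>n n)"
    and "T > 0"
  shows "(\<lambda>n. SUP (t, x)\<in>{0..T} \<times> {0..1}. \<bar>interpolate n (Zn n) t x - Z t x\<bar>) \<longlonglongrightarrow> 0"
proof (rule LIMSEQ_I)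
  fix \<epsilon> :: real assume \<epsilon>: "\<epsilon> > 0"
  have Zcont: "continuous_on ({0..} \<times> {0..1}) (\<lambda>(t, x). Z t x)"
    and Z1: "\<And>t. t \<ge> 0 \<Longrightarrow> Z t 1 = 0"
    using assms(8) unfolding obstacle_solution_def by blast+
  \<comment> \<open>One quarter of \<open>\<epsilon>\<close> goes to the node values and one to the
    oscillation of \<open>Z\<close> over a mesh width; the resulting \<open>\<epsilon> / 2\<close>
    stays strictly below \<open>\<epsilon>\<close> after the supremum is taken.\<close>
  obtain N where N: "N \<ge> 2" "\<And>n k t. n \<ge> N \<Longrightarrow> k \<le> n \<Longrightarrow> t \<in> {0..T} \<Longrightarrow>
      \<bar>zero_bdry n (Zn n) k t - Z t (real k / real n)\<bar> \<le> \<epsilon> / 4"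
    using skorohod_grid_estimate[OF assms(5,8) _ assms(10), of Zn \<eta>n "\<epsilon> / 4"] assms(9) \<epsilon> by auto
  obtain \<rho> where \<rho>: "\<rho> > 0"
    "\<And>t x t' x'. t \<in> {0..T} \<Longrightarrow> t' \<in> {0..T} \<Longrightarrow> x \<in> {0..1} \<Longrightarrow> x' \<in> {0..1} \<Longrightarrow>
       \<bar>t - t'\<bar> < \<rho> \<Longrightarrow> \<bar>x - x'\<bar> < \<rho> \<Longrightarrow> \<bar>Z t x - Z t' x'\<bar> < \<epsilon> / 4"
    using uniform_modulus[OF Zcont, of "\<epsilon> / 4"] \<epsilon> by auto
  obtain N' :: nat where N': "1 / \<rho> < real N'" using reals_Archimedean2 by blast
  show "\<exists>no. \<forall>n\<ge>no. norm ((SUP (t, x)\<in>{0..T} \<times> {0..1}. \<bar>interpolate n (Zn n) t x - Z t x\<bar>) - 0) < \<epsilon>"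
  proof (intro exI[of _ "max N N'"] allI impI)
    fix n assume "n \<ge> max N N'"
    then have n: "n \<ge> N" "n \<ge> N'" "n \<ge> 1" using N(1) by auto
    have "1 < \<rho> * real N'" using N' \<rho>(1) by (simp add: field_simps)
    also have "\<dots> \<le> \<rho> * real n" using \<rho>(1) n by simp
    finally have mesh: "1 / real n < \<rho>" using n by (simp add: field_simps)
    have bound: "\<bar>interpolate n (Zn n) t x - Z t x\<bar> \<le> \<epsilon> / 2" if "t \<in> {0..T}" "x \<in> {0..1}" for t x
    proof -
      have "\<bar>interpolate n (Zn n) t x - Z t x\<bar> \<le> \<epsilon> / 4 + \<epsilon> / 4"
      proof (rule interpolate_close)
        show "\<bar>Z t y - Z t x\<bar> \<le> \<epsilon> / 4" if "y \<in> {0..1}" "\<bar>y - x\<bar> \<le> 1 / real n" for y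
          using \<rho>(2)[of t t y x] that \<open>t \<in> {0..T}\<close> \<open>x \<in> {0..1}\<close> mesh \<rho>(1) by auto
      qed (use that n N Z1 \<epsilon> in auto)
      then show ?thesis by simp
    qed
    let ?f = "\<lambda>(t, x). \<bar>interpolate n (Zn n) t x - Z t x\<bar>"
    have "Sup (?f ` ({0..T} \<times> {0..1})) \<le> \<epsilon> / 2"
      using assms(10) bound by (intro cSUP_least) auto
    \<comment> \<open>A lower bound on a real \<open>Sup\<close> needs an upper bound of the set,
      which \<open>bound\<close> supplies; the point \<open>(0, 0)\<close> provides a non-negative
      member.\<close>
    moreover have "0 \<le> Sup (?f ` ({0..T} \<times> {0..1}))"
    proof (rule cSUP_upper2)
      show "bdd_above (?f ` ({0..T} \<times> {0..1}))"
        using bound by (intro bdd_aboveI2[where M="\<epsilon> / 2"]) auto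
      show "(0::real, 0::real) \<in> {0..T} \<times> {0..1}" using assms(10) by simp
    qed simp
    ultimately show "norm (Sup (?f ` ({0..T} \<times> {0..1})) - 0) < \<epsilon>" using \<epsilon> by simp
  qed
qed

end
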